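(* Let $\vec{v}\in\mathbb{R}^3$ be a non-zero vector. Planes and grim reapers are the only translating solitons with respect to $\vec{v}$ that are the sum of two planar curves. That is: let $I,J\subset\mathbb{R}$ be open intervals, let $\alpha:I\to\mathbb{R}^3$ and $\beta:J\to\mathbb{R}^3$ be smooth curves, each of which is contained in some plane of $\mathbb{R}^3$ (the two planes being arbitrary), and suppose that $X(s,t)=\alpha(s)+\beta(t)$, $(s,t)\in I\times J$, parametrizes a regular surface that is a translating soliton with respect to $\vec{v}$. Then the surface is (part of) a plane or a grim reaper.
   Context: $\mathbb{R}^3$ is Euclidean space with its standard inner product $\langle\cdot,\cdot\rangle$. A translating soliton with respect to a non-zero vector $\vec{v}\in\mathbb{R}^3$ is a smooth surface $M\subset\mathbb{R}^3$ whose mean curvature $H$ satisfies $H(p)=\langle N(p),\vec{v}\rangle$ for all $p\in M$, where $N$ is the unit normal vector field on $M$. The convention is that $H$ is the average of the two principal curvatures with respect to $N$ (half the trace of the shape operator); thus for a graph $z=u(x,y)$ with $\vec{v}=(v_1,v_2,v_3)$ the equation reads $$(1+u_y^2)u_{xx}-2u_xu_yu_{xy}+(1+u_x^2)u_{yy}=2(1+u_x^2+u_y^2)(-v_1u_x-v_2u_y+v_3).$$ A cylindrical surface is a surface invariant under a one-parameter group of translations (i.e. ruled by parallel straight lines). A grim reaper (with respect to $\vec{v}$) is a non-planar cylindrical surface that is a translating soliton with respect to $\vec{v}$; its rulings are necessarily not parallel to $\vec{v}$. No relation is assumed between $\vec{v}$ and the curves or the coordinates. *)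

theory Defs
  imports "HOL-Analysis.Analysis"
begin

primrec Ck_on :: "nat \<Rightarrow> 'a::real_normed_vector set \<Rightarrow> ('a \<Rightarrow> 'b::real_normed_vector) \<Rightarrow> bool"
  where
    "Ck_on 0 S f \<longleftrightarrow> continuous_on S f"
  | "Ck_on (Suc k) S f \<longleftrightarrow>
       (\<forall>x\<in>S. f differentiable (at x)) \<and>
       (\<forall>h. Ck_on k S (\<lambda>x. frechet_derivative f (at x) h))"

(* Meant for open S only: the derivatives are taken in the whole space. *)
definition smooth_on :: "'a::real_normed_vector set \<Rightarrow> ('a \<Rightarrow> 'b::real_normed_vector) \<Rightarrow> bool"
  where "smooth_on S f \<longleftrightarrow> (\<forall>k. Ck_on k S f)"

definition is_plane :: "(real^3) set \<Rightarrow> bool"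
  where "is_plane P \<longleftrightarrow> affine P \<and> aff_dim P = 2"

definition regular_patch :: "(real \<times> real) set \<Rightarrow> (real \<times> real \<Rightarrow> real^3) \<Rightarrow> bool"
  where "regular_patch U X \<longleftrightarrow>
    open U \<and> smooth_on U X \<and> (\<forall>q\<in>U. inj (frechet_derivative X (at q)))"

definition unit_normal :: "(real \<times> real \<Rightarrow> real^3) \<Rightarrow> real \<times> real \<Rightarrow> real^3"
  where "unit_normal X q =
    sgn (cross3 (frechet_derivative X (at q) (1, 0)) (frechet_derivative X (at q) (0, 1)))"

(* The shape operator S = -dN acts on the tangent plane, the range of dX.
   Here it is transported to the parameter plane by dX, i.e. this is the A with
   dX o A = S o dX.  It exists and is unique on a regular patch, and has the
   same trace as S. *)
definition shape_operator ::
    "(real \<times> real \<Rightarrow> real^3) \<Rightarrow> real \<times> real \<Rightarrow> real \<times> real \<Rightarrow> real \<times> real"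
  where "shape_operator X q = (THE A. linear A \<and>
    (\<forall>w. frechet_derivative X (at q) (A w) = - frechet_derivative (unit_normal X) (at q) w))"

definition mean_curvature :: "(real \<times> real \<Rightarrow> real^3) \<Rightarrow> real \<times> real \<Rightarrow> real"
  where "mean_curvature X q = (\<Sum>b\<in>Basis. shape_operator X q b \<bullet> b) / 2"

definition soliton_patch ::
    "real^3 \<Rightarrow> (real \<times> real) set \<Rightarrow> (real \<times> real \<Rightarrow> real^3) \<Rightarrow> bool"
  where "soliton_patch v U X \<longleftrightarrow> regular_patch U X \<and>
    (\<forall>q\<in>U. mean_curvature X q = unit_normal X q \<bullet> v)"

(* A regular (embedded) surface without boundary, described by local
   parametrizations.  Changing the parametrization multiplies both sides of the
   soliton equation by the same sign, so one parametrization around each point is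
   enough and no orientation has to be chosen. *)
definition translating_soliton :: "real^3 \<Rightarrow> (real^3) set \<Rightarrow> bool"
  where "translating_soliton v M \<longleftrightarrow>
    (\<forall>p\<in>M. \<exists>V U X Y. open V \<and> p \<in> V \<and> soliton_patch v U X \<and> homeomorphism U (M \<inter> V) X Y)"

definition cylindrical :: "(real^3) set \<Rightarrow> bool"
  where "cylindrical M \<longleftrightarrow> (\<exists>w. w \<noteq> 0 \<and> (\<forall>r. (+) (r *\<^sub>R w) ` M = M))"

(* Connectedness excludes, e.g., the disjoint union of two parallel planes, which
   is not contained in a single plane. *)
definition grim_reaper :: "real^3 \<Rightarrow> (real^3) set \<Rightarrow> bool"
  where "grim_reaper v M \<longleftrightarrow> translating_soliton v M \<and> connected M \<and> cylindrical M \<and>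
    \<not> (\<exists>P. is_plane P \<and> M \<subseteq> P)"

end

theory Submission imports Defs begin

text \<open>With \<open>a = \<alpha>'\<close>, \<open>b = \<beta>'\<close> and \<open>c = a \<times> b\<close>, the soliton equation reads
  \<open>|b|\<^sup>2 \<langle>c, a'\<rangle> + |a|\<^sup>2 \<langle>c, b'\<rangle> = 2 |c|\<^sup>2 \<langle>c, v\<rangle>\<close>. If the two planes are not parallel, let \<open>F\<close> and
  \<open>G\<close> be the slopes of the curves with respect to the common direction of the planes. The equation becomes
  \<open>(1 + G\<^sup>2) \<phi>(s) + (1 + F\<^sup>2) \<psi>(t) = M(F, G)\<close> with a cubic polynomial \<open>M\<close>. If neither curve is a
  line, \<open>F\<close> and \<open>G\<close> take infinitely many values, so this is a polynomial identity and \<open>M\<close> vanishes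
  at the complex points \<open>(\<i>, \<plusminus>\<i>)\<close>, which forces \<open>v = 0\<close>. Hence one of the curves lies on a line, say
  of direction \<open>w\<close>. For such a cylinder, the coordinate of \<open>\<alpha>\<close> along \<open>w \<times> v\<close> is either constant, and
  then the surface is planar, or strictly monotone, and then the full cylinder over \<open>\<alpha>\<close> is embedded.\<close>

subsection \<open>Smooth maps\<close>

text \<open>On an open set, \<open>f\<close> and \<open>g\<close> agree near each point, so their
  derivatives agree too. This permits replacing \<open>frechet_derivative\<close> by a formula valid
  only on \<open>S\<close>.\<close>

lemma Ck_on_cong:
  assumes "open S" "\<And>x. x \<in> S \<Longrightarrow> f x = g x" "Ck_on k S f"
  shows "Ck_on k S g"
  using assms(2,3)
proof (induction k arbitrary: f g)
  case 0
  then have "continuous_on S f" by simp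
  then show ?case using 0(1) continuous_on_cong[of S S f g] by simp
next
  case (Suc k)
  have g: "(g has_derivative frechet_derivative f (at x)) (at x)" if "x \<in> S" for x
  proof (rule has_derivative_transform_within_open[OF _ \<open>open S\<close> that])
    show "(f has_derivative frechet_derivative f (at x)) (at x)"
      using Suc.prems that by (simp add: frechet_derivative_works[symmetric])
  qed (rule Suc.prems)
  then have eq: "frechet_derivative f (at x) = frechet_derivative g (at x)" if "x \<in> S" for x
    using frechet_derivative_at that by blast
  have "Ck_on k S (\<lambda>x. frechet_derivative g (at x) h)" for h
  proof (rule Suc.IH)
    show "Ck_on k S (\<lambda>x. frechet_derivative f (at x) h)" using Suc.prems by simp
  qed (simp add: eq)
  then show ?case using g by (auto simp: differentiable_def)
qed

lemma Ck_on_const: "Ck_on k S (\<lambda>x. c)"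
  by (induction k arbitrary: c) (auto simp: frechet_derivative_const)

lemma smooth_on_bounded_linear:
  assumes "bounded_linear L"
  shows "smooth_on S L"
  unfolding smooth_on_def
proof
  fix k
  have L: "(L has_derivative L) (at x)" for x
    using assms by (rule bounded_linear_imp_has_derivative)
  then have "frechet_derivative L (at x) = L" for x
    using frechet_derivative_at by metis
  with L assms show "Ck_on k S L"
    by (cases k) (auto simp: linear_continuous_on Ck_on_const differentiable_def)
qed

lemma Ck_on_add:
  assumes "open S" "Ck_on k S f" "Ck_on k S g"
  shows "Ck_on k S (\<lambda>x. f x + g x)"
  using assms(2,3)
proof (induction k arbitrary: f g)
  case 0
  then show ?case by (simp add: continuous_on_add)
next
  case (Suc k)
  have "Ck_on k S (\<lambda>x. frechet_derivative (\<lambda>x. f x + g x) (at x) h)" for h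
  proof (rule Ck_on_cong[OF \<open>open S\<close>])
    show "Ck_on k S (\<lambda>x. frechet_derivative f (at x) h + frechet_derivative g (at x) h)"
      using Suc by simp
    fix x assume "x \<in> S"
    with Suc.prems have "((\<lambda>x. f x + g x) has_derivative
      (\<lambda>h. frechet_derivative f (at x) h + frechet_derivative g (at x) h)) (at x)"
      by (intro has_derivative_add) (auto simp: frechet_derivative_works[symmetric])
    then show "frechet_derivative f (at x) h + frechet_derivative g (at x) h =
        frechet_derivative (\<lambda>x. f x + g x) (at x) h"
      using frechet_derivative_at by metis
  qed
  then show ?case using Suc.prems by simp
qed

text \<open>The derivative of \<open>f \<circ> fst\<close> in direction \<open>h\<close> is the
  derivative of \<open>f\<close> in direction \<open>fst h\<close>, composed with
  \<open>fst\<close>. It has the same shape, so the induction closes once \<open>f\<close> is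
  generalized.\<close>

lemma Ck_on_compose_fst:
  assumes "open S" "open T" "Ck_on k S f"
  shows "Ck_on k (S \<times> T) (\<lambda>x. f (fst x))"
  using assms(3)
proof (induction k arbitrary: f)
  case 0
  then show ?case
    by (auto intro: continuous_on_compose2[OF _ continuous_on_fst[OF continuous_on_id]])
next
  case (Suc k)
  have d: "((\<lambda>x. f (fst x)) has_derivative (\<lambda>h. frechet_derivative f (at (fst x)) (fst h))) (at x)"
    if "x \<in> S \<times> T" for x
  proof -
    have "(f has_derivative frechet_derivative f (at (fst x))) (at (fst x))"
      using Suc.prems that by (auto simp: frechet_derivative_works[symmetric])
    from has_derivative_compose[OF has_derivative_fst[OF has_derivative_ident] this]
    show ?thesis by simp
  qed
  have "Ck_on k (S \<times> T) (\<lambda>x. frechet_derivative (\<lambda>x. f (fst x)) (at x) h)" for h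
  proof (rule Ck_on_cong)
    show "open (S \<times> T)" using assms by (simp add: open_Times)
    show "Ck_on k (S \<times> T) (\<lambda>x. frechet_derivative f (at (fst x)) (fst h))"
      using Suc.IH[of "\<lambda>x. frechet_derivative f (at x) (fst h)"] Suc.prems by simp
  qed (use d frechet_derivative_at in metis)
  then show ?case using d by (simp only: Ck_on.simps differentiable_def) blast
qed

text \<open>Supplies the velocity and acceleration in which the second-order soliton equation is
  written.\<close>

lemma smooth_on_imp_C2:
  fixes \<alpha> :: "real \<Rightarrow> 'a::real_normed_vector"
  assumes "smooth_on I \<alpha>"
  obtains a a' where "\<And>s. s \<in> I \<Longrightarrow> (\<alpha> has_vector_derivative a s) (at s)"
    "\<And>s. s \<in> I \<Longrightarrow> (a has_vector_derivative a' s) (at s)"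
proof
  have *: "(f has_vector_derivative frechet_derivative f (at s) 1) (at s)"
    if "f differentiable at s" for f :: "real \<Rightarrow> 'a" and s
    using vector_derivative_works[THEN iffD1, OF that]
      frechet_derivative_eq_vector_derivative[OF that] by simp
  have "Ck_on (Suc (Suc 0)) I \<alpha>" using assms by (simp only: smooth_on_def)
  then have d: "\<alpha> differentiable at s" "(\<lambda>s. frechet_derivative \<alpha> (at s) 1) differentiable at s"
    if "s \<in> I" for s
    using that by simp_all
  show "(\<alpha> has_vector_derivative frechet_derivative \<alpha> (at s) 1) (at s)" if "s \<in> I" for s
    by (rule *[OF d(1)[OF that]])
  show "((\<lambda>s. frechet_derivative \<alpha> (at s) 1) has_vector_derivative 
      frechet_derivative (\<lambda>s. frechet_derivative \<alpha> (at s) 1) (at s) 1) (at s)" if "s \<in> I" for s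
    by (rule *[OF d(2)[OF that]])
qed

subsection \<open>Mean curvature of a sum of two curves\<close>

text \<open>Cramer's rule in the basis \<open>a\<close>, \<open>b\<close>,
  \<open>cross3 a b\<close>, multiplied by its determinant so that it also holds for dependent
  \<open>a\<close> and \<open>b\<close>.\<close>

lemma tangent_decomposition:
  fixes a b x :: "real^3"
  shows "(cross3 a b \<bullet> cross3 a b) *\<^sub>R x = 
    (cross3 x b \<bullet> cross3 a b) *\<^sub>R a + (cross3 a x \<bullet> cross3 a b) *\<^sub>R b + (x \<bullet> cross3 a b) *\<^sub>R cross3 a b"
  by (simp add: vec_eq_iff forall_3 cross3_def inner_vec_def sum_3 vector_def) algebra

lemma inner_cross3_self [simp]: "cross3 a b \<bullet> a = 0" "cross3 a b \<bullet> b = 0"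
  "a \<bullet> cross3 a b = 0" "b \<bullet> cross3 a b = 0"
  using dot_cross_self by (auto simp: inner_commute)

lemma inner_cross3_swap: "cross3 x b \<bullet> a = - (cross3 a b \<bullet> x)" "cross3 a x \<bullet> b = - (cross3 a b \<bullet> x)"
  by (simp_all add: cross3_def inner_vec_def sum_3 vector_def algebra_simps)

lemma bounded_bilinear_cross3: "bounded_bilinear cross3"
  using bilinear_cross bilinear_conv_bounded_bilinear by blast

lemma cross3_nonzero_combination:
  assumes "cross3 a b \<noteq> 0" "h *\<^sub>R a + k *\<^sub>R b = 0"
  shows "h = 0 \<and> k = 0"
proof -
  have "cross3 (h *\<^sub>R a + k *\<^sub>R b) b = h *\<^sub>R cross3 a b" "cross3 a (h *\<^sub>R a + k *\<^sub>R b) = k *\<^sub>R cross3 a b"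
    by (simp_all add: cross_add_left cross_add_right cross_mult_left cross_mult_right)
  with assms show ?thesis by (metis cross_zero_left cross_zero_right scale_eq_0_iff)
qed

text \<open>The classical quotient of fundamental forms: the mixed second derivative of
  \<open>X\<close> vanishes, so only the terms |b|^2 <c, a'> and |a|^2 <c, b'> survive, over 2 |c|^2
  and the factor |c| from the unit normal.\<close>

lemma mean_curvature_sum_of_curves:
  fixes \<alpha> \<beta> a b :: "real \<Rightarrow> real^3" and a' b' :: "real^3"
  assumes "open I" "open J" and q: "s \<in> I" "t \<in> J"
    and \<alpha>: "\<And>s. s \<in> I \<Longrightarrow> (\<alpha> has_vector_derivative a s) (at s)"
    and \<beta>: "\<And>t. t \<in> J \<Longrightarrow> (\<beta> has_vector_derivative b t) (at t)"
    and a: "(a has_vector_derivative a') (at s)"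
    and b: "(b has_vector_derivative b') (at t)"
  defines "X \<equiv> \<lambda>(s, t). \<alpha> s + \<beta> t" and "c \<equiv> cross3 (a s) (b t)"
  shows "frechet_derivative X (at (s, t)) = (\<lambda>w. fst w *\<^sub>R a s + snd w *\<^sub>R b t)"
    and "unit_normal X (s, t) = sgn c"
    and "c \<noteq> 0 \<Longrightarrow> mean_curvature X (s, t) =
      ((b t \<bullet> b t) * (c \<bullet> a') + (a s \<bullet> a s) * (c \<bullet> b')) / (2 * norm c ^ 3)"
proof -
  have dX: "frechet_derivative X (at q) = (\<lambda>w. fst w *\<^sub>R a (fst q) + snd w *\<^sub>R b (snd q))"
    if "q \<in> I \<times> J" for q
  proof -
    have "((\<lambda>x. \<alpha> (fst x)) has_derivative (\<lambda>w. fst w *\<^sub>R a (fst q))) (at q)"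
      using \<alpha>[of "fst q"] that unfolding has_vector_derivative_def
      by (intro has_derivative_compose[OF has_derivative_fst[OF has_derivative_ident]]) auto
    moreover have "((\<lambda>x. \<beta> (snd x)) has_derivative (\<lambda>w. snd w *\<^sub>R b (snd q))) (at q)"
      using \<beta>[of "snd q"] that unfolding has_vector_derivative_def
      by (intro has_derivative_compose[OF has_derivative_snd[OF has_derivative_ident]]) auto
    ultimately have "(X has_derivative (\<lambda>w. fst w *\<^sub>R a (fst q) + snd w *\<^sub>R b (snd q))) (at q)"
      unfolding X_def case_prod_unfold by (rule has_derivative_add)
    then show ?thesis by (simp only: frechet_derivative_at[symmetric])
  qed
  show dXq: "frechet_derivative X (at (s, t)) = (\<lambda>w. fst w *\<^sub>R a s + snd w *\<^sub>R b t)"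
    using dX[of "(s, t)"] q by simp
  have N: "unit_normal X q = sgn (cross3 (a (fst q)) (b (snd q)))" if "q \<in> I \<times> J" for q
    using dX[OF that] by (simp add: unit_normal_def)
  then show "unit_normal X (s, t) = sgn c" using q by (simp add: c_def)
  assume c0: "c \<noteq> 0"
  define r where "r = norm c"
  have r: "r \<noteq> 0" "c \<bullet> c = r\<^sup>2" using c0 by (simp_all add: r_def power2_norm_eq_inner)
  define dc where "dc w = fst w *\<^sub>R cross3 a' (b t) + snd w *\<^sub>R cross3 (a s) b'" for w :: "real \<times> real"
  have "((\<lambda>q. a (fst q)) has_derivative (\<lambda>w. fst w *\<^sub>R a')) (at (s, t))"
    using a unfolding has_vector_derivative_def
    by (intro has_derivative_compose[OF has_derivative_fst[OF has_derivative_ident]]) auto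
  moreover have "((\<lambda>q. b (snd q)) has_derivative (\<lambda>w. snd w *\<^sub>R b')) (at (s, t))"
    using b unfolding has_vector_derivative_def
    by (intro has_derivative_compose[OF has_derivative_snd[OF has_derivative_ident]]) auto
  ultimately have dc: "((\<lambda>q. cross3 (a (fst q)) (b (snd q))) has_derivative dc) (at (s, t))"
    using bounded_bilinear.FDERIV[OF bounded_bilinear_cross3]
    by (fastforce simp: dc_def[abs_def] cross_mult_left cross_mult_right add.commute)
  \<comment> \<open>Derivative of c / |c|: the part of \<open>dc w\<close> orthogonal to
    \<open>c\<close>, divided by |c|.\<close>
  define dN where "dN w = inverse r *\<^sub>R dc w - (inverse r ^ 3 * (c \<bullet> dc w)) *\<^sub>R c" for w
  have "((\<lambda>q. sgn (cross3 (a (fst q)) (b (snd q)))) has_derivative dN) (at (s, t))"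
  proof -
    have "((\<lambda>q. norm (cross3 (a (fst q)) (b (snd q)))) has_derivative (\<lambda>w. dc w \<bullet> sgn c)) (at (s, t))"
      using has_derivative_compose[OF dc has_derivative_norm[of "cross3 (a (fst (s, t))) (b (snd (s, t)))"]] c0
      by (simp add: c_def)
    then show ?thesis unfolding sgn_div_norm
      using dc r c0 
      by (auto intro!: derivative_eq_intros simp: c_def[symmetric] r_def[symmetric] dN_def[abs_def]
         sgn_div_norm inner_commute power3_eq_cube)
  qed
  then have "(unit_normal X has_derivative dN) (at (s, t))"
    by (rule has_derivative_transform_within_open[where s = "I \<times> J"])
      (use assms N in \<open>auto simp: open_Times\<close>)
  then have dNf: "frechet_derivative (unit_normal X) (at (s, t)) = dN"
    by (simp only: frechet_derivative_at[symmetric])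
  \<comment> \<open>The differential of a unit field is orthogonal to it. Hence the normal component
    in \<open>tangent_decomposition\<close> drops out and \<open>dN w\<close> lies in the range of
    dX.\<close>
  have dN_c: "dN w \<bullet> c = 0" for w
  proof -
    have "c \<bullet> dN w = inverse r * (c \<bullet> dc w) - inverse r ^ 3 * (c \<bullet> dc w) * r\<^sup>2"
      by (simp add: dN_def inner_diff_right r(2))
    also have "\<dots> = 0" using r(1) by (simp add: field_simps power2_eq_square power3_eq_cube)
    finally show ?thesis by (simp only: inner_commute)
  qed
  have lin: "linear dN"
    by (intro linearI) (simp_all add: dN_def dc_def algebra_simps inner_add_right)
  \<comment> \<open>The coordinates of \<open>- dN w\<close> in the basis \<open>a s\<close>,
    \<open>b t\<close>, by Cramer's rule.\<close>
  define A where "A w = (- (cross3 (dN w) (b t) \<bullet> c) / r\<^sup>2, - (cross3 (a s) (dN w) \<bullet> c) / r\<^sup>2)" for w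
  have linA: "linear A"
    by (intro linearI) (simp_all add: A_def linear_add[OF lin] linear_scale[OF lin] cross_add_left cross_add_right
       cross_mult_left cross_mult_right inner_add_left algebra_simps add_divide_distrib diff_divide_distrib)
  have A: "frechet_derivative X (at (s, t)) (A w) = - dN w" for w
  proof -
    have "r\<^sup>2 *\<^sub>R dN w = (cross3 (dN w) (b t) \<bullet> c) *\<^sub>R a s + (cross3 (a s) (dN w) \<bullet> c) *\<^sub>R b t"
      using tangent_decomposition[of "a s" "b t" "dN w"] dN_c r by (simp add: c_def)
    then have "dN w = inverse (r\<^sup>2) *\<^sub>R ((cross3 (dN w) (b t) \<bullet> c) *\<^sub>R a s + (cross3 (a s) (dN w) \<bullet> c) *\<^sub>R b t)"
      using r(1) by (metis inverse_zero_imp_zero left_inverse power_not_zero scaleR_one scaleR_scaleR)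
    then show ?thesis by (simp add: dXq A_def scaleR_add_right divide_inverse algebra_simps)
  qed
  have "shape_operator X (s, t) = A"
    unfolding shape_operator_def dNf
  proof (rule the_equality)
    show "linear A \<and> (\<forall>w. frechet_derivative X (at (s, t)) (A w) = - dN w)" using linA A by simp
    \<comment> \<open>Uniqueness for the definite description: \<open>a s\<close> and
      \<open>b t\<close> are independent, so dX is injective.\<close>
    fix B assume B: "linear B \<and> (\<forall>w. frechet_derivative X (at (s, t)) (B w) = - dN w)"
    show "B = A"
    proof
      fix w
      have "frechet_derivative X (at (s, t)) (B w) = frechet_derivative X (at (s, t)) (A w)"
        using A B by metis
      then have "(fst (B w) - fst (A w)) *\<^sub>R a s + (snd (B w) - snd (A w)) *\<^sub>R b t = 0"
        by (simp add: dXq algebra_simps)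
      from cross3_nonzero_combination[OF _ this] c0 show "B w = A w"
        by (simp add: c_def prod_eq_iff)
    qed
  qed
  then have "2 * mean_curvature X (s, t) = fst (A (1, 0)) + snd (A (0, 1))"
    by (simp add: mean_curvature_def Basis_prod_def inner_prod_def sum.union_disjoint image_image)
  also have "\<dots> = - (cross3 (dN (1, 0)) (b t) \<bullet> c + cross3 (a s) (dN (0, 1)) \<bullet> c) / r\<^sup>2"
    by (simp add: A_def add_divide_distrib diff_divide_distrib)
  also have "cross3 (dN (1, 0)) (b t) \<bullet> c = - inverse r * (b t \<bullet> b t) * (c \<bullet> a')"
  proof -
    have "cross3 (dN (1, 0)) (b t) \<bullet> c = (dN (1, 0) \<bullet> a s) * (b t \<bullet> b t) - (dN (1, 0) \<bullet> b t) * (b t \<bullet> a s)"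
      by (simp add: c_def dot_cross)
    \<comment> \<open>The second product vanishes because \<open>dc (1, 0)\<close> is a' x b,
      orthogonal to b: here the absence of a mixed second derivative enters.\<close>
    moreover have "dN (1, 0) \<bullet> a s = - inverse r * (c \<bullet> a')" "dN (1, 0) \<bullet> b t = 0"
      by (simp_all add: dN_def dc_def inner_diff_left c_def inner_cross3_swap(1)[of a' "b t" "a s"])
    ultimately show ?thesis by simp
  qed
  also have "cross3 (a s) (dN (0, 1)) \<bullet> c = - inverse r * (a s \<bullet> a s) * (c \<bullet> b')"
  proof -
    have "cross3 (a s) (dN (0, 1)) \<bullet> c = (a s \<bullet> a s) * (dN (0, 1) \<bullet> b t) - (a s \<bullet> b t) * (dN (0, 1) \<bullet> a s)"
      by (simp add: c_def dot_cross)
    moreover have "dN (0, 1) \<bullet> b t = - inverse r * (c \<bullet> b')" "dN (0, 1) \<bullet> a s = 0"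
      by (simp_all add: dN_def dc_def inner_diff_left c_def inner_cross3_swap(2)[of "a s" b' "b t"])
    ultimately show ?thesis by simp
  qed
  finally show "mean_curvature X (s, t) =
      ((b t \<bullet> b t) * (c \<bullet> a') + (a s \<bullet> a s) * (c \<bullet> b')) / (2 * norm c ^ 3)"
    using r by (simp add: r_def[symmetric] field_simps power2_eq_square power3_eq_cube)
qed

text \<open>With unit normal c / |c|, multiplying the soliton equation by 2 |c|^3 clears all
  denominators and square roots.\<close>

lemma soliton_equation_iff:
  fixes \<alpha> \<beta> a b :: "real \<Rightarrow> real^3" and a' b' :: "real^3"
  assumes "open I" "open J" "s \<in> I" "t \<in> J"
    "\<And>s. s \<in> I \<Longrightarrow> (\<alpha> has_vector_derivative a s) (at s)"
    "\<And>t. t \<in> J \<Longrightarrow> (\<beta> has_vector_derivative b t) (at t)"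
    "(a has_vector_derivative a') (at s)" "(b has_vector_derivative b') (at t)"
  defines "X \<equiv> \<lambda>(s, t). \<alpha> s + \<beta> t" and "c \<equiv> cross3 (a s) (b t)"
  assumes "c \<noteq> 0"
  shows "mean_curvature X (s, t) = unit_normal X (s, t) \<bullet> v \<longleftrightarrow>
    (b t \<bullet> b t) * (c \<bullet> a') + (a s \<bullet> a s) * (c \<bullet> b') = 2 * (c \<bullet> c) * (c \<bullet> v)"
proof -
  define r and k where "r = norm c" and "k = c \<bullet> v"
  have r: "r \<noteq> 0" "c \<bullet> c = r\<^sup>2" using \<open>c \<noteq> 0\<close> by (simp_all add: r_def power2_norm_eq_inner)
  have "y / (2 * r ^ 3) = k / r \<longleftrightarrow> y = 2 * r\<^sup>2 * k" for y
    using r(1) by (auto simp: field_simps power2_eq_square power3_eq_cube)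
  moreover have "mean_curvature X (s, t) =
      ((b t \<bullet> b t) * (c \<bullet> a') + (a s \<bullet> a s) * (c \<bullet> b')) / (2 * r ^ 3)"
    unfolding X_def c_def r_def
    by (rule mean_curvature_sum_of_curves(3)[OF assms(1-8)]) (use \<open>c \<noteq> 0\<close> c_def in auto)
  moreover have "unit_normal X (s, t) = sgn c"
    unfolding X_def c_def by (rule mean_curvature_sum_of_curves(2)[OF assms(1-8)])
  then have "unit_normal X (s, t) \<bullet> v = k / r"
    by (simp add: sgn_div_norm r_def k_def divide_inverse mult.commute)
  ultimately show ?thesis by (simp only: r(2) k_def)
qed

subsection \<open>Separation of variables\<close>

text \<open>A one-variable polynomial with infinitely many roots is zero; apply this first in
  \<open>z\<close> for each \<open>w\<close> in \<open>G\<close>, then in \<open>w\<close> for every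
  \<open>z\<close>. Polynomiality is stated in each variable separately, so univariate polynomials
  suffice.\<close>

lemma bivariate_polynomial_eq_0:
  fixes h :: "complex \<Rightarrow> complex \<Rightarrow> complex"
  assumes pz: "\<And>w. \<exists>p. \<forall>z. h z w = poly p z" and pw: "\<And>z. \<exists>p. \<forall>w. h z w = poly p w"
    and inf: "infinite F" "infinite G" and h: "\<And>z w. z \<in> F \<Longrightarrow> w \<in> G \<Longrightarrow> h z w = 0"
  shows "h z w = 0"
proof -
  have zero: "k z = 0" if k: "\<exists>p. \<forall>z. k z = poly p z" "infinite S" "\<And>z. z \<in> S \<Longrightarrow> k z = 0"
    for k :: "complex \<Rightarrow> complex" and S z
  proof -
    obtain p where p: "\<forall>z. k z = poly p z" using k(1) by blast
    have "p = 0"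
    proof (rule ccontr)
      assume "p \<noteq> 0"
      then have "finite {z. poly p z = 0}" by (rule poly_roots_finite)
      moreover have "S \<subseteq> {z. poly p z = 0}" using k(3) p by auto
      ultimately show False using k(2) finite_subset by blast
    qed
    with p show ?thesis by simp
  qed
  have "h z w = 0" if "w \<in> G" for w z
    using zero[OF pz inf(1)] h that by blast
  then show ?thesis using zero[OF pw inf(2)] by blast
qed

text \<open>The factors 1 + f^2 and 1 + g^2 have no real zeros, so the identity is first extended to
  complex arguments, where they can be made to vanish simultaneously.\<close>

lemma separated_cubic_trivial:
  fixes f \<phi> :: "'a \<Rightarrow> real" and g \<psi> :: "'b \<Rightarrow> real" and A B D c :: real
  assumes inf: "infinite (f ` S)" "infinite (g ` T)" and "c\<^sup>2 \<noteq> 1"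
    and eq: "\<And>s t. s \<in> S \<Longrightarrow> t \<in> T \<Longrightarrow> (1 + (g t)\<^sup>2) * \<phi> s + (1 + (f s)\<^sup>2) * \<psi> t =
      (1 - c\<^sup>2 + (f s)\<^sup>2 + (g t)\<^sup>2 - 2 * c * f s * g t) * (A * f s + B * g t + D)"
  shows "A = 0 \<and> B = 0 \<and> D = 0"
proof -
  obtain s0 t0 where st0: "s0 \<in> S" "t0 \<in> T"
    using inf by (metis all_not_in_conv finite.emptyI image_is_empty)
  define f0 g0 \<phi>0 \<psi>0 where "f0 = f s0" "g0 = g t0" "\<phi>0 = \<phi> s0" "\<psi>0 = \<psi> t0"
  note defs = this
  define m :: "complex \<Rightarrow> complex \<Rightarrow> complex" where
    "m z w = (1 - c\<^sup>2 + z\<^sup>2 + w\<^sup>2 - 2 * c * z * w) * (A * z + B * w + D)" for z w :: complex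
  define K where "K = (1 + f0\<^sup>2) * (1 + g0\<^sup>2)"
  \<comment> \<open>\<open>h\<close> arises from \<open>eq\<close> by eliminating \<open>\<phi> s\<close> and \<open>\<psi> t\<close> with its instances at \<open>t0\<close> and \<open>s0\<close>.\<close>
  define h :: "complex \<Rightarrow> complex \<Rightarrow> complex" where
    "h z w = K * m z w - (1 + w\<^sup>2) * (1 + f0\<^sup>2) * (m z g0 - (1 + z\<^sup>2) * \<psi>0)
       - (1 + z\<^sup>2) * (1 + g0\<^sup>2) * (m f0 w - (1 + w\<^sup>2) * \<phi>0)" for z w :: complex
  have "h z w = 0" for z w
  proof (rule bivariate_polynomial_eq_0[where h = h and F = "complex_of_real ` f ` S" and G = "complex_of_real ` g ` T"])
    show "infinite (complex_of_real ` f ` S)" "infinite (complex_of_real ` g ` T)"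
      using inf by (auto simp: finite_image_iff inj_on_def)
    show "\<exists>p. \<forall>z. h z w = poly p z" for w
    proof -
      \<comment> \<open>\<open>m z w\<close> as a polynomial in \<open>z\<close>: the quadratic
        factor times the linear one, coefficients listed from the constant term upwards.\<close>
      define m1 where "m1 w = [:1 - complex_of_real (c\<^sup>2) + w\<^sup>2, - 2 * c * w, 1:] * [:B * w + D, A:]" for w :: complex
      have "m z w = poly (m1 w) z" for z w
        by (simp add: m_def m1_def algebra_simps power2_eq_square)
      then have "h z w = poly (smult K (m1 w) - smult ((1 + w\<^sup>2) * (1 + f0\<^sup>2)) (m1 g0 - smult \<psi>0 [:1, 0, 1:])
          - smult ((1 + g0\<^sup>2) * (m f0 w - (1 + w\<^sup>2) * \<phi>0)) [:1, 0, 1:]) z" for z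
        by (simp add: h_def algebra_simps power2_eq_square)
      then show ?thesis by blast
    qed
    show "\<exists>p. \<forall>w. h z w = poly p w" for z
    proof -
      define m1 where "m1 z = [:1 - complex_of_real (c\<^sup>2) + z\<^sup>2, - 2 * c * z, 1:] * [:A * z + D, B:]" for z :: complex
      have "m z w = poly (m1 z) w" for z w
        by (simp add: m_def m1_def algebra_simps power2_eq_square)
      then have "h z w = poly (smult K (m1 z) - smult ((1 + z\<^sup>2) * (1 + g0\<^sup>2)) (m1 f0 - smult \<phi>0 [:1, 0, 1:])
          - smult ((1 + f0\<^sup>2) * (m z g0 - (1 + z\<^sup>2) * \<psi>0)) [:1, 0, 1:]) w" for w
        by (simp add: h_def algebra_simps power2_eq_square)
      then show ?thesis by blast
    qed
    fix z w assume "z \<in> complex_of_real ` f ` S" "w \<in> complex_of_real ` g ` T"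
    then obtain s t where st: "s \<in> S" "t \<in> T" "z = f s" "w = g t" by blast
    define mr where "mr x y = (1 - c\<^sup>2 + x\<^sup>2 + y\<^sup>2 - 2 * c * x * y) * (A * x + B * y + D)" for x y
    have m: "m (complex_of_real x) (complex_of_real y) = complex_of_real (mr x y)" for x y
      by (simp add: m_def mr_def)
    define x y \<phi>s \<psi>t where "x = f s" "y = g t" "\<phi>s = \<phi> s" "\<psi>t = \<psi> t"
    note xy = this
    have 1: "mr x y = (1 + y\<^sup>2) * \<phi>s + (1 + x\<^sup>2) * \<psi>t" and "(1 + g0\<^sup>2) * \<phi>s + (1 + x\<^sup>2) * \<psi>0 = mr x g0"
      "(1 + y\<^sup>2) * \<phi>0 + (1 + f0\<^sup>2) * \<psi>t = mr f0 y"
      using eq st st0 unfolding mr_def defs xy by metis+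
    then have 2: "mr x g0 - (1 + x\<^sup>2) * \<psi>0 = (1 + g0\<^sup>2) * \<phi>s"
      "mr f0 y - (1 + y\<^sup>2) * \<phi>0 = (1 + f0\<^sup>2) * \<psi>t" by linarith+
    have "K * mr x y - (1 + y\<^sup>2) * (1 + f0\<^sup>2) * (mr x g0 - (1 + x\<^sup>2) * \<psi>0)
       - (1 + x\<^sup>2) * (1 + g0\<^sup>2) * (mr f0 y - (1 + y\<^sup>2) * \<phi>0) = 0"
      unfolding K_def 1 2 by algebra
    then have "complex_of_real (K * mr x y - (1 + y\<^sup>2) * (1 + f0\<^sup>2) * (mr x g0 - (1 + x\<^sup>2) * \<psi>0)
       - (1 + x\<^sup>2) * (1 + g0\<^sup>2) * (mr f0 y - (1 + y\<^sup>2) * \<phi>0)) = 0" by (simp only: of_real_0)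
    then show "h z w = 0" unfolding h_def st(3,4) m xy[symmetric] by simp
  qed
  \<comment> \<open>At these points 1 + z^2 = 1 + w^2 = 0, so \<open>h\<close> reduces to
    \<open>K * m\<close>, with \<open>K\<close> nonzero because \<open>f0\<close> and
    \<open>g0\<close> are real.\<close>
  then have h0: "h \<i> \<i> = 0" "h \<i> (- \<i>) = 0" by auto
  have "1 + f0\<^sup>2 \<noteq> 0" "1 + g0\<^sup>2 \<noteq> 0" by (simp_all add: add_nonneg_eq_0_iff)
  then have "complex_of_real K \<noteq> 0" unfolding K_def of_real_eq_0_iff by simp
  with h0 have m0: "m \<i> \<i> = 0" "m \<i> (- \<i>) = 0" by (simp_all add: h_def)
  \<comment> \<open>The quadratic factor takes the values -(1 - c)^2 and -(1 + c)^2, nonzero since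
    c^2 differs from 1. So the linear factor vanishes, and its real and imaginary parts give D = 0
    and A + B = A - B = 0.\<close>
  have "m \<i> \<i> = - complex_of_real ((1 - c)\<^sup>2) * Complex D (A + B)"
    "m \<i> (- \<i>) = - complex_of_real ((1 + c)\<^sup>2) * Complex D (A - B)"
    by (simp_all add: m_def complex_eq_iff power2_eq_square algebra_simps)
  moreover have "1 - c \<noteq> 0" "1 + c \<noteq> 0" using \<open>c\<^sup>2 \<noteq> 1\<close> by (auto simp: power2_eq_1_iff)
  then have "complex_of_real ((1 - c)\<^sup>2) \<noteq> 0" "complex_of_real ((1 + c)\<^sup>2) \<noteq> 0"
    unfolding of_real_eq_0_iff by simp_all
  ultimately have "Complex D (A + B) = 0" "Complex D (A - B) = 0"
    using m0 by (metis mult_eq_0_iff neg_equal_0_iff_equal)+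
  then show ?thesis by (auto simp: complex_eq_iff)
qed

text \<open>The last hypothesis says that the Wronskian is nonzero at \<open>s\<close>. If
  \<open>q s\<close> is nonzero, the slope p / q has nonzero derivative there; otherwise
  \<open>p s\<close> is nonzero and the same argument applies to q / p.\<close>

lemma infinite_slopes:
  fixes p q p' q' :: "real \<Rightarrow> real"
  assumes "open I" "s \<in> I"
    and "\<And>s. s \<in> I \<Longrightarrow> (p has_real_derivative p' s) (at s)"
    and "\<And>s. s \<in> I \<Longrightarrow> (q has_real_derivative q' s) (at s)"
    and "p' s * q s - q' s * p s \<noteq> 0"
  shows "infinite ((\<lambda>s. p s / q s) ` {s \<in> I. q s \<noteq> 0})"
proof -
  have inf: "infinite ((\<lambda>s. p s / q s) ` {s \<in> I. q s \<noteq> 0})"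
    if p: "\<And>s. s \<in> I \<Longrightarrow> (p has_real_derivative p' s) (at s)"
      and q: "\<And>s. s \<in> I \<Longrightarrow> (q has_real_derivative q' s) (at s)"
      and k: "p' s * q s - q' s * p s \<noteq> 0" and "q s \<noteq> 0" for p q p' q' :: "real \<Rightarrow> real"
  proof
    let ?S = "{s \<in> I. q s \<noteq> 0}"
    assume fin: "finite ((\<lambda>s. p s / q s) ` ?S)"
    have "continuous_on I q"
      using q by (meson DERIV_isCont continuous_at_imp_continuous_on)
    then have "open ?S"
      using continuous_open_preimage[OF _ \<open>open I\<close>, of q "- {0}"] by (simp add: vimage_def Int_def open_Compl)
    then obtain r where r: "r > 0" "ball s r \<subseteq> ?S" using \<open>s \<in> I\<close> \<open>q s \<noteq> 0\<close> open_contains_ball by blast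
    have d: "((\<lambda>s. p s / q s) has_real_derivative (p' u * q u - q' u * p u) / (q u)\<^sup>2) (at u)" if "u \<in> ?S" for u
      using that by (auto intro!: derivative_eq_intros p q simp: power2_eq_square mult.commute)
    then have "continuous_on ?S (\<lambda>s. p s / q s)"
      by (meson DERIV_isCont continuous_at_imp_continuous_on)
    \<comment> \<open>A connected finite set has at most one point, so finitely many values would
      make the slope constant near \<open>s\<close>, against its nonzero derivative.\<close>
    then have "connected ((\<lambda>s. p s / q s) ` ball s r)"
      using r continuous_on_subset connected_continuous_image connected_ball by metis
    moreover have "finite ((\<lambda>s. p s / q s) ` ball s r)" using fin r(2) by (meson finite_subset image_mono)
    ultimately obtain x where "(\<lambda>s. p s / q s) ` ball s r = {x}"
      using connected_finite_iff_sing r(1) by (metis centre_in_ball empty_iff image_is_empty)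
    then have x: "p u / q u = x" if "u \<in> ball s r" for u using that by blast
    have "((\<lambda>s. p s / q s) has_real_derivative 0) (at s)"
    proof (rule has_field_derivative_transform_within_open[of "\<lambda>_. x" 0 s "ball s r"])
      show "x = p u / q u" if "u \<in> ball s r" for u using x[OF that] by simp
    qed (use r in auto)
    then show False using d \<open>s \<in> I\<close> \<open>q s \<noteq> 0\<close> k DERIV_unique by fastforce
  qed
  show ?thesis
  proof (cases "q s = 0")
    case False
    then show ?thesis using inf assms by blast
  next
    case True
    with assms have "p s \<noteq> 0" "q' s * p s - p' s * q s \<noteq> 0" by auto
    then have "infinite ((\<lambda>s. q s / p s) ` {s \<in> I. p s \<noteq> 0})"
      using inf[of q q' p p'] assms by blast
    \<comment> \<open>Dropping the value 0 keeps the set infinite, and inverting the remaining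
      values of q / p yields values of p / q where \<open>q\<close> is nonzero.\<close>
    then have "infinite (inverse ` ((\<lambda>s. q s / p s) ` {s \<in> I. p s \<noteq> 0} - {0}))"
      by (subst finite_image_iff) (auto simp: inj_on_def)
    moreover have "inverse ` ((\<lambda>s. q s / p s) ` {s \<in> I. p s \<noteq> 0} - {0}) \<subseteq> (\<lambda>s. p s / q s) ` {s \<in> I. q s \<noteq> 0}"
      by (auto simp: image_iff)
    ultimately show ?thesis by (meson finite_subset)
  qed
qed

subsection \<open>Sums of curves in non-parallel planes\<close>

text \<open>The equation of \<open>soliton_equation_iff\<close> as an algebraic relation between
  velocities \<open>a\<close>, \<open>b\<close> and accelerations \<open>a'\<close>,
  \<open>b'\<close> at one pair of parameters.\<close>

definition soliton_eq :: "real^3 \<Rightarrow> real^3 \<Rightarrow> real^3 \<Rightarrow> real^3 \<Rightarrow> real^3 \<Rightarrow> bool" where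
  "soliton_eq v a a' b b' \<longleftrightarrow> (b \<bullet> b) * (cross3 a b \<bullet> a') + (a \<bullet> a) * (cross3 a b \<bullet> b') =
     2 * (cross3 a b \<bullet> cross3 a b) * (cross3 a b \<bullet> v)"

text \<open>Exchanging the curves changes the sign of \<open>cross3 a b\<close>, in which both sides
  are odd.\<close>

lemma soliton_eq_swap: "soliton_eq v b b' a a' \<longleftrightarrow> soliton_eq v a a' b b'"
  by (auto simp: soliton_eq_def cross_skew[of b a])

section \<open>Planes, their unit normals and curves in them\<close>

lemma is_plane_hyperplane: "n \<noteq> 0 \<Longrightarrow> is_plane {x. n \<bullet> x = d}"
  by (simp add: is_plane_def affine_hyperplane)

lemma is_plane_unit_normal:
  assumes "is_plane P"
  obtains n d where "n \<bullet> n = 1" "P = {x. n \<bullet> x = d}"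
proof -
  have "aff_dim P = DIM(real^3) - 1" "affine hull P = P"
    using assms by (simp_all add: is_plane_def affine_hull_eq)
  then obtain m d where m: "m \<noteq> 0" "P = {x. m \<bullet> x = d}"
    using aff_dim_eq_hyperplane[of P] by metis
  show thesis
  proof
    show "sgn m \<bullet> sgn m = 1"
      using m(1) by (simp add: power2_norm_eq_inner[symmetric] norm_sgn)
    show "P = {x. sgn m \<bullet> x = d / norm m}"
      using m by (auto simp: sgn_div_norm field_simps)
  qed
qed

lemma has_vector_derivative_inner_left:
  "(f has_vector_derivative f') F \<Longrightarrow> ((\<lambda>x. n \<bullet> f x) has_real_derivative n \<bullet> f') F"
  using bounded_linear.has_vector_derivative[OF bounded_linear_inner_right]
  by (simp add: has_real_derivative_iff_has_vector_derivative)

lemma derivative_in_plane: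
  fixes f :: "real \<Rightarrow> real^3"
  assumes "open I" "s \<in> I" "(f has_vector_derivative f') (at s)" "\<And>s. s \<in> I \<Longrightarrow> n \<bullet> f s = d"
  shows "n \<bullet> f' = 0"
proof -
  have "((\<lambda>s. n \<bullet> f s) has_real_derivative 0) (at s)"
    by (rule has_field_derivative_transform_within_open[of "\<lambda>_. d" 0 s I]) (use assms in auto)
  then show ?thesis
    using has_vector_derivative_inner_left[OF assms(3)] DERIV_unique by blast
qed

section \<open>Frames adapted to the common direction of two planes\<close>

lemma cross3_cross3_common: "cross3 (cross3 u e) (cross3 x e) = (e \<bullet> cross3 u x) *\<^sub>R e"
  by (simp add: vec_eq_iff forall_3 cross3_def inner_vec_def sum_3 vector_def) algebra

lemma inner_cross3_cyclic: "cross3 x y \<bullet> z = cross3 y z \<bullet> x" "z \<bullet> cross3 x y = x \<bullet> cross3 y z"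
  using cross_triple[of x y z] by (simp_all add: inner_commute)

text \<open>In the plane orthogonal to \<open>n\<close>, the vectors \<open>e\<close> and
  \<open>cross3 n e\<close> are orthogonal and of equal length; \<open>e\<close> is not normalized,
  whence the divisions.\<close>

lemma adapted_frame_expansion:
  fixes n e x :: "real^3"
  assumes "n \<bullet> n = 1" "e \<bullet> n = 0" "x \<bullet> n = 0" "e \<bullet> e \<noteq> 0"
  shows "x = ((e \<bullet> x) / (e \<bullet> e)) *\<^sub>R e + ((cross3 n e \<bullet> x) / (e \<bullet> e)) *\<^sub>R cross3 n e"
proof -
  have "(e \<bullet> e) *\<^sub>R x = (e \<bullet> x) *\<^sub>R e + (cross3 n e \<bullet> x) *\<^sub>R cross3 n e"
    using tangent_decomposition[of n e x] assms by (simp add: dot_cross inner_commute)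
  then have "inverse (e \<bullet> e) *\<^sub>R (e \<bullet> e) *\<^sub>R x =
      inverse (e \<bullet> e) *\<^sub>R ((e \<bullet> x) *\<^sub>R e + (cross3 n e \<bullet> x) *\<^sub>R cross3 n e)" by simp
  then show ?thesis using assms(4) by (simp add: scaleR_add_right divide_inverse mult.commute)
qed

text \<open>Here \<open>e\<close> spans the common direction of the planes, and p / q and P / Q are
  the slopes of the velocities. The terms p' q - q' p and P' Q - Q' P are the numerators of the
  derivatives of the slopes.\<close>

lemma soliton_eq_adapted_frame:
  fixes n1 n2 v :: "real^3" and p q p' q' P Q P' Q' :: real
  assumes n: "n1 \<bullet> n1 = 1" "n2 \<bullet> n2 = 1"
  defines "e \<equiv> cross3 n1 n2" and "c \<equiv> n1 \<bullet> n2"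
  defines "f1 \<equiv> cross3 n1 e" and "f2 \<equiv> cross3 n2 e"
  assumes "e \<noteq> 0"
    and eq: "soliton_eq v (p *\<^sub>R e + q *\<^sub>R f1) (p' *\<^sub>R e + q' *\<^sub>R f1) (P *\<^sub>R e + Q *\<^sub>R f2) (P' *\<^sub>R e + Q' *\<^sub>R f2)"
  shows "(P\<^sup>2 + Q\<^sup>2) * Q * (p' * q - q' * p) + (p\<^sup>2 + q\<^sup>2) * q * (P' * Q - Q' * P) =
    2 * ((1 - c\<^sup>2) * q\<^sup>2 * Q\<^sup>2 + p\<^sup>2 * Q\<^sup>2 + P\<^sup>2 * q\<^sup>2 - 2 * c * p * q * P * Q)
      * (p * Q * (n2 \<bullet> v) - q * P * (n1 \<bullet> v) + q * Q * (e \<bullet> v))"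
proof -
  define E where "E = 1 - c\<^sup>2"
  have ee: "e \<bullet> e = E" using n by (simp add: e_def dot_cross c_def E_def inner_commute power2_eq_square)
  then have E0: "E \<noteq> 0" using \<open>e \<noteq> 0\<close> by auto
  have en: "e \<bullet> n1 = 0" "e \<bullet> n2 = 0" "n1 \<bullet> e = 0" "n2 \<bullet> e = 0" by (simp_all add: e_def)
  have ff: "e \<bullet> f1 = 0" "f1 \<bullet> e = 0" "e \<bullet> f2 = 0" "f2 \<bullet> e = 0" "f1 \<bullet> f1 = E" "f2 \<bullet> f2 = E"
    using n en ee by (simp_all add: f1_def f2_def dot_cross)
  have nf: "n1 \<bullet> f1 = 0" "n2 \<bullet> f2 = 0" "n1 \<bullet> f2 = E" "n2 \<bullet> f1 = - E"
    using ee inner_cross3_cyclic(2)[where x = n1 and y = n2 and z = e]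
      inner_cross3_cyclic(2)[where x = n2 and y = n1 and z = e]
    by (simp_all add: f1_def f2_def e_def[symmetric] cross_skew[of n2 n1])
  have cr: "cross3 e f1 = E *\<^sub>R n1" "cross3 e f2 = E *\<^sub>R n2" "cross3 f1 e = - E *\<^sub>R n1"
    using ee en by (simp_all add: f1_def f2_def Lagrange cross_skew[of _ e])
  have cr': "cross3 f1 f2 = E *\<^sub>R e"
    unfolding f1_def f2_def cross3_cross3_common e_def[symmetric] ee ..
  define N where "N = (p * Q) *\<^sub>R n2 - (q * P) *\<^sub>R n1 + (q * Q) *\<^sub>R e"
  have c: "cross3 (p *\<^sub>R e + q *\<^sub>R f1) (P *\<^sub>R e + Q *\<^sub>R f2) = E *\<^sub>R N"
    by (simp add: N_def cross_add_left cross_add_right cross_mult_left cross_mult_right cr cr' algebra_simps)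
  have 1: "N \<bullet> (p' *\<^sub>R e + q' *\<^sub>R f1) = E * Q * (p' * q - q' * p)"
    "N \<bullet> (P' *\<^sub>R e + Q' *\<^sub>R f2) = E * q * (P' * Q - Q' * P)"
    "N \<bullet> v = p * Q * (n2 \<bullet> v) - q * P * (n1 \<bullet> v) + q * Q * (e \<bullet> v)"
    "N \<bullet> N = E * q\<^sup>2 * Q\<^sup>2 + p\<^sup>2 * Q\<^sup>2 + P\<^sup>2 * q\<^sup>2 - 2 * c * p * q * P * Q"
    by (simp_all add: N_def inner_add_left inner_add_right inner_diff_left inner_diff_right nf ff en ee n c_def
        inner_commute[of n2 n1] algebra_simps power2_eq_square)
  have 2: "(p *\<^sub>R e + q *\<^sub>R f1) \<bullet> (p *\<^sub>R e + q *\<^sub>R f1) = E * (p\<^sup>2 + q\<^sup>2)"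
    "(P *\<^sub>R e + Q *\<^sub>R f2) \<bullet> (P *\<^sub>R e + Q *\<^sub>R f2) = E * (P\<^sup>2 + Q\<^sup>2)"
    by (simp_all add: inner_add_left inner_add_right ee ff algebra_simps power2_eq_square)
  \<comment> \<open>Both sides carry E^3: on the left from a squared length, the normal
    \<open>E *\<^sub>R N\<close> and its product with an acceleration; on the right from three
    factors of the normal.\<close>
  have "E ^ 3 * ((P\<^sup>2 + Q\<^sup>2) * Q * (p' * q - q' * p) + (p\<^sup>2 + q\<^sup>2) * q * (P' * Q - Q' * P)) =
    E ^ 3 * (2 * (N \<bullet> N) * (N \<bullet> v))"
    using eq unfolding soliton_eq_def c 2 inner_scaleR_left inner_scaleR_right 1(1,2)
    by (simp add: algebra_simps power3_eq_cube)
  then have "(P\<^sup>2 + Q\<^sup>2) * Q * (p' * q - q' * p) + (p\<^sup>2 + q\<^sup>2) * q * (P' * Q - Q' * P) = 2 * (N \<bullet> N) * (N \<bullet> v)"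
    using E0 by simp
  then show ?thesis unfolding 1 E_def .
qed

text \<open>A vanishing product of velocity and acceleration means zero curvature. If both curves
  bend somewhere, both slopes take infinitely many values, and
  \<open>separated_cubic_trivial\<close> makes \<open>v\<close> orthogonal to \<open>n1\<close>,
  \<open>n2\<close> and \<open>e\<close>, which span the space.\<close>

lemma soliton_of_planar_curves_straight:
  fixes n1 n2 v :: "real^3" and a a' b b' :: "real \<Rightarrow> real^3"
  assumes "open I" "open J" and "v \<noteq> 0" and n: "n1 \<bullet> n1 = 1" "n2 \<bullet> n2 = 1" "cross3 n1 n2 \<noteq> 0"
    and a: "\<And>s. s \<in> I \<Longrightarrow> (a has_vector_derivative a' s) (at s)"
    and b: "\<And>t. t \<in> J \<Longrightarrow> (b has_vector_derivative b' t) (at t)"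
    and na: "\<And>s. s \<in> I \<Longrightarrow> n1 \<bullet> a s = 0" and nb: "\<And>t. t \<in> J \<Longrightarrow> n2 \<bullet> b t = 0"
    and eq: "\<And>s t. s \<in> I \<Longrightarrow> t \<in> J \<Longrightarrow> soliton_eq v (a s) (a' s) (b t) (b' t)"
  shows "(\<forall>s\<in>I. cross3 (a s) (a' s) = 0) \<or> (\<forall>t\<in>J. cross3 (b t) (b' t) = 0)"
proof (rule ccontr)
  assume "\<not> ?thesis"
  then obtain s0 t0 where st0: "s0 \<in> I" "cross3 (a s0) (a' s0) \<noteq> 0" "t0 \<in> J" "cross3 (b t0) (b' t0) \<noteq> 0"
    by blast
  define e c where "e = cross3 n1 n2" and "c = n1 \<bullet> n2"
  have e0: "e \<bullet> e \<noteq> 0" and en: "e \<bullet> n1 = 0" "e \<bullet> n2 = 0" using n by (simp_all add: e_def)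
  have "e \<bullet> e = 1 - c\<^sup>2" using n by (simp add: e_def dot_cross c_def inner_commute power2_eq_square)
  then have c1: "c\<^sup>2 \<noteq> 1" using e0 by auto
  define x y where "x n u = (e \<bullet> u) / (e \<bullet> e)" and "y n u = (cross3 n e \<bullet> u) / (e \<bullet> e)" for n u :: "real^3"
  have na': "n1 \<bullet> a' s = 0" if "s \<in> I" for s using derivative_in_plane[OF \<open>open I\<close> that a[OF that] na] .
  have nb': "n2 \<bullet> b' t = 0" if "t \<in> J" for t using derivative_in_plane[OF \<open>open J\<close> that b[OF that] nb] .
  have expand: "u = x n u *\<^sub>R e + y n u *\<^sub>R cross3 n e" if "n \<bullet> u = 0" "n \<in> {n1, n2}" for n u
  proof -
    have "n \<bullet> n = 1" "e \<bullet> n = 0" "u \<bullet> n = 0" using that n en by (auto simp: inner_commute[of u])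
    then show ?thesis unfolding x_def y_def using e0 by (rule adapted_frame_expansion)
  qed
  have slopes: "infinite ((\<lambda>s. x m (f s) / y m (f s)) ` {s \<in> K. y m (f s) \<noteq> 0})"
    if K: "open K" "s \<in> K" and f: "\<And>s. s \<in> K \<Longrightarrow> (f has_vector_derivative f' s) (at s)"
      and m: "m \<in> {n1, n2}" "\<And>s. s \<in> K \<Longrightarrow> m \<bullet> f s = 0" and k: "cross3 (f s) (f' s) \<noteq> 0"
    for K s m and f f' :: "real \<Rightarrow> real^3"
  proof (rule infinite_slopes[OF K])
    show "((\<lambda>s. x m (f s)) has_real_derivative x m (f' s)) (at s)"
      "((\<lambda>s. y m (f s)) has_real_derivative y m (f' s)) (at s)" if "s \<in> K" for s
      unfolding x_def y_def
      by (intro DERIV_cdivide has_vector_derivative_inner_left f that)+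
    have "m \<bullet> f' s = 0" using derivative_in_plane[OF K f[OF K(2)] m(2)] .
    then have "f s = x m (f s) *\<^sub>R e + y m (f s) *\<^sub>R cross3 m e"
      "f' s = x m (f' s) *\<^sub>R e + y m (f' s) *\<^sub>R cross3 m e"
      using expand m K(2) by blast+
    then have "cross3 (f s) (f' s) = 
      cross3 (x m (f s) *\<^sub>R e + y m (f s) *\<^sub>R cross3 m e) (x m (f' s) *\<^sub>R e + y m (f' s) *\<^sub>R cross3 m e)"
      by (rule arg_cong2)
    \<comment> \<open>Up to sign, the Wronskian of the two coordinates is the coefficient of
      velocity x acceleration, so nonzero curvature makes it nonzero.\<close>
    also have "\<dots> = (x m (f s) * y m (f' s) - x m (f' s) * y m (f s)) *\<^sub>R cross3 e (cross3 m e)"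
      by (simp add: cross_add_left cross_add_right cross_mult_left cross_mult_right
        cross_skew[of "cross3 m e" e] algebra_simps)
    finally show "x m (f' s) * y m (f s) - y m (f' s) * x m (f s) \<noteq> 0"
      using k by (auto simp: mult.commute)
  qed
  define f g where "f s = x n1 (a s) / y n1 (a s)" and "g t = x n2 (b t) / y n2 (b t)" for s t
  \<comment> \<open>Dividing the equation in frame coordinates by q^3 Q^3 turns its left side into
    (1 + G^2) \<phi> + (1 + F^2) \<psi>, with each of \<phi> and \<psi> depending on one parameter
    only.\<close>
  define \<phi> where "\<phi> s = (x n1 (a' s) * y n1 (a s) - y n1 (a' s) * x n1 (a s)) / (y n1 (a s)) ^ 3" for s
  define \<psi> where "\<psi> t = (x n2 (b' t) * y n2 (b t) - y n2 (b' t) * x n2 (b t)) / (y n2 (b t)) ^ 3" for t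
  have "2 * (n2 \<bullet> v) = 0 \<and> - 2 * (n1 \<bullet> v) = 0 \<and> 2 * (e \<bullet> v) = 0"
  proof (rule separated_cubic_trivial[OF _ _ c1])
    show "infinite (f ` {s \<in> I. y n1 (a s) \<noteq> 0})" unfolding f_def
      by (rule slopes) (use assms st0 in auto)
    show "infinite (g ` {t \<in> J. y n2 (b t) \<noteq> 0})" unfolding g_def
      by (rule slopes) (use assms st0 in auto)
    fix s t assume "s \<in> {s \<in> I. y n1 (a s) \<noteq> 0}" "t \<in> {t \<in> J. y n2 (b t) \<noteq> 0}"
    then have st: "s \<in> I" "t \<in> J" and nz: "y n1 (a s) \<noteq> 0" "y n2 (b t) \<noteq> 0" by auto
    have ex: "a s = x n1 (a s) *\<^sub>R e + y n1 (a s) *\<^sub>R cross3 n1 e" "a' s = x n1 (a' s) *\<^sub>R e + y n1 (a' s) *\<^sub>R cross3 n1 e"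
      "b t = x n2 (b t) *\<^sub>R e + y n2 (b t) *\<^sub>R cross3 n2 e" "b' t = x n2 (b' t) *\<^sub>R e + y n2 (b' t) *\<^sub>R cross3 n2 e"
      by (rule expand, use st na na' nb nb' in auto)+
    define p q p' q' where "p = x n1 (a s)" "q = y n1 (a s)" "p' = x n1 (a' s)" "q' = y n1 (a' s)"
    note pq = this
    define P Q P' Q' where "P = x n2 (b t)" "Q = y n2 (b t)" "P' = x n2 (b' t)" "Q' = y n2 (b' t)"
    note PQ = this
    have "soliton_eq v (p *\<^sub>R e + q *\<^sub>R cross3 n1 e) (p' *\<^sub>R e + q' *\<^sub>R cross3 n1 e)
        (P *\<^sub>R e + Q *\<^sub>R cross3 n2 e) (P' *\<^sub>R e + Q' *\<^sub>R cross3 n2 e)"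
      using eq[OF st] unfolding pq PQ by (simp only: ex[symmetric])
    then have E: "(P\<^sup>2 + Q\<^sup>2) * Q * (p' * q - q' * p) + (p\<^sup>2 + q\<^sup>2) * q * (P' * Q - Q' * P) =
      2 * ((1 - c\<^sup>2) * q\<^sup>2 * Q\<^sup>2 + p\<^sup>2 * Q\<^sup>2 + P\<^sup>2 * q\<^sup>2 - 2 * c * p * q * P * Q)
      * (p * Q * (n2 \<bullet> v) - q * P * (n1 \<bullet> v) + q * Q * (e \<bullet> v))"
      using soliton_eq_adapted_frame[OF n(1,2), folded e_def c_def] e0 by auto
    define F G where "F = p / q" and "G = P / Q"
    have nz: "q \<noteq> 0" "Q \<noteq> 0" using nz by (simp_all add: pq PQ)
    then have FG: "p = F * q" "P = G * Q" by (simp_all add: F_def G_def)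
    define k l where "k = p' * q - q' * p" and "l = P' * Q - Q' * P"
    have "Q ^ 3 * k * (1 + G\<^sup>2) + q ^ 3 * l * (1 + F\<^sup>2) =
      2 * q ^ 3 * Q ^ 3 * (1 - c\<^sup>2 + F\<^sup>2 + G\<^sup>2 - 2 * c * F * G) * (F * (n2 \<bullet> v) - G * (n1 \<bullet> v) + e \<bullet> v)"
      using E unfolding k_def[symmetric] l_def[symmetric] unfolding FG
      by (simp add: algebra_simps power2_eq_square power3_eq_cube)
    then have "(Q ^ 3 * k * (1 + G\<^sup>2) + q ^ 3 * l * (1 + F\<^sup>2)) / (q ^ 3 * Q ^ 3) =
      2 * (1 - c\<^sup>2 + F\<^sup>2 + G\<^sup>2 - 2 * c * F * G) * (F * (n2 \<bullet> v) - G * (n1 \<bullet> v) + e \<bullet> v)"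
      using nz by (simp add: divide_eq_eq)
    moreover have "(Q ^ 3 * k * (1 + G\<^sup>2) + q ^ 3 * l * (1 + F\<^sup>2)) / (q ^ 3 * Q ^ 3) =
      (1 + G\<^sup>2) * (k / q ^ 3) + (1 + F\<^sup>2) * (l / Q ^ 3)"
      using nz by (simp add: add_divide_distrib mult.commute)
    moreover have "f s = F" "g t = G" "\<phi> s = k / q ^ 3" "\<psi> t = l / Q ^ 3"
      by (simp_all add: f_def g_def \<phi>_def \<psi>_def F_def G_def k_def l_def pq PQ)
    ultimately show "(1 + (g t)\<^sup>2) * \<phi> s + (1 + (f s)\<^sup>2) * \<psi> t =
      (1 - c\<^sup>2 + (f s)\<^sup>2 + (g t)\<^sup>2 - 2 * c * f s * g t) *
      (2 * (n2 \<bullet> v) * f s + - 2 * (n1 \<bullet> v) * g t + 2 * (e \<bullet> v))"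
      by (simp add: algebra_simps)
  qed
  then have v: "n1 \<bullet> v = 0" "n2 \<bullet> v = 0" "e \<bullet> v = 0" by auto
  \<comment> \<open>All coefficients of \<open>v\<close> in the basis \<open>n1\<close>,
    \<open>n2\<close>, \<open>e\<close> are built from the three vanishing inner products.\<close>
  have "(e \<bullet> e) *\<^sub>R v = 0"
    using tangent_decomposition[of n1 n2 v] v by (simp add: e_def[symmetric] inner_commute[of v] dot_cross)
      (simp add: e_def dot_cross v inner_commute[of v])
  with e0 \<open>v \<noteq> 0\<close> show False by simp
qed

subsection \<open>Cylinders\<close>

text \<open>The derivative of c / |c| is the part of c' orthogonal to c, divided by |c|, and c' is
  parallel to c. This serves both for the tangent of a straight curve and for the normal of a planar
  cylinder.\<close>

lemma constant_direction:
  fixes c c' :: "real \<Rightarrow> real^3"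
  assumes "is_interval I" "open I"
    and c: "\<And>s. s \<in> I \<Longrightarrow> (c has_vector_derivative c' s) (at s)"
    and c0: "\<And>s. s \<in> I \<Longrightarrow> c s \<noteq> 0" and par: "\<And>s. s \<in> I \<Longrightarrow> cross3 (c s) (c' s) = 0"
  obtains u where "\<And>s. s \<in> I \<Longrightarrow> sgn (c s) = u"
proof -
  have "((\<lambda>s. sgn (c s)) has_derivative (\<lambda>h. 0)) (at s within I)" if s: "s \<in> I" for s
  proof -
    define r where "r = norm (c s)"
    have r: "r \<noteq> 0" "c s \<bullet> c s = r\<^sup>2" using c0[OF s] by (simp_all add: r_def power2_norm_eq_inner)
    have "cross3 (c s) (cross3 (c s) (c' s)) = (c s \<bullet> c' s) *\<^sub>R c s - (c s \<bullet> c s) *\<^sub>R c' s"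
      by (rule Lagrange)
    then have "r\<^sup>2 *\<^sub>R c' s = (c s \<bullet> c' s) *\<^sub>R c s" using par[OF s] r(2) by simp
    then have "inverse (r\<^sup>2) *\<^sub>R r\<^sup>2 *\<^sub>R c' s = (inverse (r\<^sup>2) * (c s \<bullet> c' s)) *\<^sub>R c s" by simp
    then have c's: "c' s = (inverse (r\<^sup>2) * (c s \<bullet> c' s)) *\<^sub>R c s" using r(1) by simp
    have "((\<lambda>s. norm (c s)) has_derivative (\<lambda>h. (h *\<^sub>R c' s) \<bullet> sgn (c s))) (at s)"
      using has_derivative_compose[OF c[OF s, unfolded has_vector_derivative_def] has_derivative_norm] c0[OF s]
      by simp
    moreover have "(c has_derivative (\<lambda>h. h *\<^sub>R c' s)) (at s)"
      using c[OF s] by (simp add: has_vector_derivative_def)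
    moreover have "inverse r *\<^sub>R (h *\<^sub>R c' s) - (inverse r * ((h *\<^sub>R c' s) \<bullet> sgn (c s)) * inverse r) *\<^sub>R c s = 0" for h
    proof -
      have 1: "inverse r * ((h *\<^sub>R c' s) \<bullet> sgn (c s)) * inverse r = inverse r * h * (inverse (r\<^sup>2) * (c s \<bullet> c' s))"
        by (simp add: sgn_div_norm r_def[symmetric] power2_eq_square inner_commute)
      have 2: "inverse r *\<^sub>R (h *\<^sub>R c' s) = (inverse r * h * (inverse (r\<^sup>2) * (c s \<bullet> c' s))) *\<^sub>R c s"
        by (subst c's) simp
      show ?thesis unfolding 1 2 by simp
    qed
    ultimately have "((\<lambda>s. sgn (c s)) has_derivative (\<lambda>h. 0)) (at s)"
      unfolding sgn_div_norm using r(1)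
      by (auto intro!: derivative_eq_intros simp: r_def[symmetric] sgn_div_norm algebra_simps)
    then show ?thesis by (rule has_derivative_at_withinI)
  qed
  then obtain u where "\<And>s. s \<in> I \<Longrightarrow> sgn (c s) = u"
    using has_derivative_zero_constant[of I "\<lambda>s. sgn (c s)"] \<open>is_interval I\<close>
    by (auto simp: is_interval_convex_1)
  then show thesis by (rule that)
qed

text \<open>The height along w x v is constant on rulings and, by the last hypothesis, has nonzero
  derivative along the curve. It therefore determines \<open>s\<close>, so the full cylinder does
  not meet itself and \<open>X\<close> is a homeomorphism onto its image.\<close>

lemma translating_cylinder_image:
  fixes \<gamma> a a' :: "real \<Rightarrow> real^3" and w v :: "real^3"
  assumes I: "is_interval I" "open I" "I \<noteq> {}" and sm: "smooth_on I \<gamma>"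
    and \<gamma>: "\<And>s. s \<in> I \<Longrightarrow> (\<gamma> has_vector_derivative a s) (at s)"
    and a: "\<And>s. s \<in> I \<Longrightarrow> (a has_vector_derivative a' s) (at s)"
    and w: "w \<bullet> w = 1" and nz: "\<And>s. s \<in> I \<Longrightarrow> cross3 (a s) w \<noteq> 0"
    and eq: "\<And>s. s \<in> I \<Longrightarrow> soliton_eq v (a s) (a' s) w 0"
    and nv: "\<And>s. s \<in> I \<Longrightarrow> cross3 (a s) w \<bullet> v \<noteq> 0"
  defines "X \<equiv> \<lambda>(s, r). \<gamma> s + r *\<^sub>R w"
  shows "translating_soliton v (X ` (I \<times> UNIV))"
proof -
  define n where "n = cross3 w v"
  have wn: "n \<bullet> w = 0" by (simp add: n_def)
  have na: "n \<bullet> a s = cross3 (a s) w \<bullet> v" for s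
    by (simp only: n_def cross_triple[of "a s" w v])
  have dh: "((\<lambda>s. n \<bullet> \<gamma> s) has_real_derivative n \<bullet> a s) (at s)" if "s \<in> I" for s
    using \<gamma>[OF that] by (rule has_vector_derivative_inner_left)
  have contg: "continuous_on I \<gamma>"
    using \<gamma> by (meson continuous_at_imp_continuous_on has_vector_derivative_continuous)
  have conth: "continuous_on I (\<lambda>s. n \<bullet> \<gamma> s)" by (intro continuous_intros contg)
  have noteq: "n \<bullet> \<gamma> s \<noteq> n \<bullet> \<gamma> t" if "s \<in> I" "t \<in> I" "s < t" for s t
  proof
    assume e: "n \<bullet> \<gamma> s = n \<bullet> \<gamma> t"
    have sub: "{s..t} \<subseteq> I" using mem_is_interval_1_I[OF I(1) that(1,2)] by auto
    have "\<exists>z. s < z \<and> z < t \<and> (*) (n \<bullet> a z) = (\<lambda>h. 0)"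
    proof (rule Rolle_deriv[OF \<open>s < t\<close> e continuous_on_subset[OF conth sub]])
      fix z assume "s < z" "z < t"
      then show "((\<lambda>s. n \<bullet> \<gamma> s) has_derivative (*) (n \<bullet> a z)) (at z)"
        using dh[of z] sub by (simp add: has_field_derivative_def subset_iff)
    qed
    then obtain z where z: "s < z" "z < t" "(*) (n \<bullet> a z) = (\<lambda>h. 0)" by blast
    from fun_cong[OF z(3), of 1] have "n \<bullet> a z = 0" by simp
    moreover have "z \<in> I" using z sub by auto
    ultimately show False using nv[of z] na by simp
  qed
  then have inj: "inj_on (\<lambda>s. n \<bullet> \<gamma> s) I" by (intro linorder_inj_onI) auto
  \<comment> \<open>A continuous injection on an open interval has a continuous inverse, by
    invariance of domain.\<close>
  obtain g where g: "homeomorphism I ((\<lambda>s. n \<bullet> \<gamma> s) ` I) (\<lambda>s. n \<bullet> \<gamma> s) g"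
    using invariance_of_domain_homeomorphism[OF I(2) conth _ inj] by auto
  define M where "M = X ` (I \<times> UNIV)"
  \<comment> \<open>The height of \<open>p\<close> gives the parameter \<open>s\<close>; the
    position on the ruling is then an inner product with the unit vector \<open>w\<close>.\<close>
  define Y where "Y p = (g (n \<bullet> p), (p - \<gamma> (g (n \<bullet> p))) \<bullet> w)" for p
  have XY: "Y (X (s, r)) = (s, r)" if "s \<in> I" for s r
    using g that wn w by (simp add: homeomorphism_def Y_def X_def inner_add_right)
  have hM: "(\<lambda>p. n \<bullet> p) ` M = (\<lambda>s. n \<bullet> \<gamma> s) ` I"
    using wn by (auto simp: M_def X_def inner_add_right image_iff)
  have contX: "continuous_on (I \<times> UNIV) X"
    unfolding X_def case_prod_unfold
    by (intro continuous_intros continuous_on_compose2[OF contg continuous_on_fst[OF continuous_on_id]]) auto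
  have cont1: "continuous_on M (\<lambda>p. g (n \<bullet> p))"
    by (rule continuous_on_compose2[of "(\<lambda>s. n \<bullet> \<gamma> s) ` I" g])
       (use g hM in \<open>auto simp: homeomorphism_def intro!: continuous_intros\<close>)
  have gM: "g ` (\<lambda>p. n \<bullet> p) ` M = I" using g hM by (simp add: homeomorphism_def)
  have contY: "continuous_on M Y"
    unfolding Y_def
    by (intro continuous_intros cont1 continuous_on_compose2[OF contg cont1]) (use gM in auto)
  have homeo: "homeomorphism (I \<times> UNIV) M X Y"
    unfolding homeomorphism_def
  proof (intro conjI)
    have XY': "Y (X q) = q" if "q \<in> I \<times> UNIV" for q using XY that by (cases q) auto
    then show "\<forall>q\<in>I \<times> UNIV. Y (X q) = q" "\<forall>p\<in>M. X (Y p) = p" by (auto simp: M_def)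
    show "Y ` M = I \<times> UNIV" unfolding M_def image_image using XY' by (simp cong: image_cong)
  qed (use contX contY in \<open>simp_all add: M_def\<close>)
  have dr: "((\<lambda>r. r *\<^sub>R w) has_vector_derivative w) (at t)" for t
    by (auto intro!: derivative_eq_intros)
  have d0: "((\<lambda>_. w) has_vector_derivative 0) (at t)" for t :: real by simp
  have "soliton_patch v (I \<times> UNIV) X"
    unfolding soliton_patch_def regular_patch_def
  proof (intro conjI ballI)
    show "open (I \<times> (UNIV :: real set))" using I by (simp add: open_Times)
    show "smooth_on (I \<times> UNIV) X"
      unfolding smooth_on_def X_def case_prod_unfold
    proof
      fix k
      have "smooth_on (I \<times> UNIV) (\<lambda>x :: real \<times> real. snd x *\<^sub>R w)"
        by (intro smooth_on_bounded_linear bounded_linear_compose[OF bounded_linear_scaleR_left bounded_linear_snd])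
      then show "Ck_on k (I \<times> UNIV) (\<lambda>p. \<gamma> (fst p) + snd p *\<^sub>R w)"
        using sm I by (intro Ck_on_add Ck_on_compose_fst) (auto simp: smooth_on_def open_Times)
    qed
    fix q assume "q \<in> I \<times> (UNIV :: real set)"
    then obtain s t where q: "q = (s, t)" "s \<in> I" by auto
    have "frechet_derivative X (at (s, t)) = (\<lambda>h. fst h *\<^sub>R a s + snd h *\<^sub>R w)"
      unfolding X_def by (rule mean_curvature_sum_of_curves(1)[OF I(2) open_UNIV q(2) UNIV_I \<gamma> dr a[OF q(2)] d0])
    moreover have "x = y" if "fst x *\<^sub>R a s + snd x *\<^sub>R w = fst y *\<^sub>R a s + snd y *\<^sub>R w" for x y :: "real \<times> real"
    proof -
      have "(fst x - fst y) *\<^sub>R a s + (snd x - snd y) *\<^sub>R w = 0" using that by (simp add: algebra_simps)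
      from cross3_nonzero_combination[OF nz[OF q(2)] this] show ?thesis by (simp add: prod_eq_iff)
    qed
    ultimately show "inj (frechet_derivative X (at q))" by (auto simp: q inj_on_def)
    show "mean_curvature X q = unit_normal X q \<bullet> v"
      unfolding X_def q(1)
      by (subst soliton_equation_iff[OF I(2) open_UNIV q(2) UNIV_I \<gamma> dr a[OF q(2)] d0 nz[OF q(2)]])
         (use eq[OF q(2)] in \<open>simp_all add: soliton_eq_def\<close>)
  qed
  \<comment> \<open>The single patch \<open>X\<close>, with V the whole space, serves around every
    point.\<close>
  then show ?thesis
    using homeo unfolding translating_soliton_def M_def[symmetric] by (metis UNIV_I inf_top_right open_UNIV)
qed

text \<open>By the soliton equation, \<open>\<langle>c, v\<rangle>\<^sup>2 / |c|\<^sup>2\<close> with \<open>c = a \<times> w\<close> has logarithmic derivative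
  \<open>-4 \<langle>u, a\<rangle>\<close>, where \<open>u\<close> is the component of \<open>v\<close> orthogonal to \<open>w\<close>. This yields the first integral
  \<open>F\<close> below, so no uniqueness theorem for differential equations is needed.\<close>

lemma translating_cylinder_dichotomy:
  fixes \<gamma> a a' :: "real \<Rightarrow> real^3" and w v :: "real^3"
  assumes I: "is_interval I" "open I"
    and \<gamma>: "\<And>s. s \<in> I \<Longrightarrow> (\<gamma> has_vector_derivative a s) (at s)"
    and a: "\<And>s. s \<in> I \<Longrightarrow> (a has_vector_derivative a' s) (at s)"
    and w: "w \<bullet> w = 1" and nz: "\<And>s. s \<in> I \<Longrightarrow> cross3 (a s) w \<noteq> 0"
    and eq: "\<And>s. s \<in> I \<Longrightarrow> soliton_eq v (a s) (a' s) w 0"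
    and st: "s \<in> I" "t \<in> I" and s0: "cross3 (a s) w \<bullet> v = 0"
  shows "cross3 (a t) w \<bullet> v = 0"
proof -
  define c where "c s = cross3 (a s) w" for s
  define u where "u = v - (w \<bullet> v) *\<^sub>R w"
  define F where "F s = ((v \<bullet> c s)\<^sup>2 / (c s \<bullet> c s)) * exp (4 * (u \<bullet> \<gamma> s))" for s
  have dc: "(c has_vector_derivative cross3 (a' s) w) (at s)" if "s \<in> I" for s
    using bounded_linear.has_vector_derivative[OF bounded_bilinear.bounded_linear_left[OF bounded_bilinear_cross3] a[OF that]]
    by (simp add: c_def[abs_def])
  have cc: "c s \<bullet> c s \<noteq> 0" if "s \<in> I" for s using nz[OF that] by (simp add: c_def)
  have "(F has_real_derivative 0) (at s)" if s: "s \<in> I" for s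
  proof -
    define d where "d = cross3 (a' s) w"
    have e: "c s \<bullet> a' s = 2 * (c s \<bullet> c s) * (c s \<bullet> v)"
      using eq[OF s] w by (simp add: soliton_eq_def c_def)
    \<comment> \<open>Up to the factor 2 <c, v>, the left side is the numerator of the derivative of
      <c, v>^2 / |c|^2. This is an identity for arbitrary vectors; the soliton equation enters only
      through \<open>e\<close>.\<close>
    have "(d \<bullet> v) * (c s \<bullet> c s) - (c s \<bullet> v) * (c s \<bullet> d) =
        - (c s \<bullet> a' s) * ((a s \<bullet> v) * (w \<bullet> w) - (a s \<bullet> w) * (w \<bullet> v))"
      unfolding c_def d_def by (simp add: cross3_def inner_vec_def sum_3 vector_def) algebra
    moreover have "u \<bullet> a s = (a s \<bullet> v) * (w \<bullet> w) - (a s \<bullet> w) * (w \<bullet> v)"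
      using w by (simp add: u_def inner_diff_right inner_commute)
    ultimately have key: "(v \<bullet> d) * (c s \<bullet> c s) - (v \<bullet> c s) * (c s \<bullet> d) = - 2 * (c s \<bullet> c s) * (v \<bullet> c s) * (u \<bullet> a s)"
      using e by (simp add: inner_commute)
    have "((\<lambda>s. c s \<bullet> c s) has_real_derivative 2 * (c s \<bullet> d)) (at s)"
      using bounded_bilinear.has_vector_derivative[OF bounded_bilinear_inner dc[OF s] dc[OF s]]
      by (simp add: d_def has_real_derivative_iff_has_vector_derivative inner_commute)
    note D = this has_vector_derivative_inner_left[OF dc[OF s], folded d_def, of v]
      has_vector_derivative_inner_left[OF \<gamma>[OF s], of u]
    have "((\<lambda>s. (v \<bullet> c s)\<^sup>2) has_real_derivative 2 * (v \<bullet> c s) * (v \<bullet> d)) (at s)"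
      "((\<lambda>s. exp (4 * (u \<bullet> \<gamma> s))) has_real_derivative exp (4 * (u \<bullet> \<gamma> s)) * (4 * (u \<bullet> a s))) (at s)"
      by (auto intro!: derivative_eq_intros D)
    from DERIV_mult[OF DERIV_divide[OF this(1) D(1) cc[OF s]] this(2)]
    have "(F has_real_derivative 
        (2 * (v \<bullet> c s) * (v \<bullet> d) * (c s \<bullet> c s) - (v \<bullet> c s)\<^sup>2 * (2 * (c s \<bullet> d))) / ((c s \<bullet> c s) * (c s \<bullet> c s)) * exp (4 * (u \<bullet> \<gamma> s))
         + exp (4 * (u \<bullet> \<gamma> s)) * (4 * (u \<bullet> a s)) * ((v \<bullet> c s)\<^sup>2 / (c s \<bullet> c s))) (at s)"
      unfolding F_def[abs_def] .
    also have "2 * (v \<bullet> c s) * (v \<bullet> d) * (c s \<bullet> c s) - (v \<bullet> c s)\<^sup>2 * (2 * (c s \<bullet> d)) =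
      2 * (v \<bullet> c s) * (- 2 * (c s \<bullet> c s) * (v \<bullet> c s) * (u \<bullet> a s))"
      unfolding key[symmetric] by (simp add: algebra_simps power2_eq_square)
    also have "2 * (v \<bullet> c s) * (- 2 * (c s \<bullet> c s) * (v \<bullet> c s) * (u \<bullet> a s)) / ((c s \<bullet> c s) * (c s \<bullet> c s)) * exp (4 * (u \<bullet> \<gamma> s))
         + exp (4 * (u \<bullet> \<gamma> s)) * (4 * (u \<bullet> a s)) * ((v \<bullet> c s)\<^sup>2 / (c s \<bullet> c s)) = 0"
      using cc[OF s] by (simp add: power2_eq_square)
    finally show ?thesis .
  qed
  then have "\<exists>k. \<forall>s\<in>I. F s = k"
    using I by (intro has_field_derivative_zero_constant) (auto simp: is_interval_convex_1 intro: has_field_derivative_at_within)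
  then have "F s = F t" using st by auto
  moreover have "F s = 0" using s0 by (simp add: F_def c_def inner_commute)
  ultimately show ?thesis using cc[OF st(2)] by (auto simp: F_def c_def inner_commute)
qed

text \<open>The curve \<beta> runs on a line of direction \<open>w\<close>, so the sum lies on a
  cylinder over a translate \<gamma> of \<alpha>. The full cylinder is taken as the enclosing set
  because \<open>cylindrical\<close> demands invariance under all translations along
  \<open>w\<close>.\<close>

lemma sum_with_line:
  fixes \<alpha> \<beta> a a' b b' :: "real \<Rightarrow> real^3" and v :: "real^3"
  assumes I: "is_interval I" "open I" "I \<noteq> {}" and J: "is_interval J" "open J" "J \<noteq> {}"
    and sm: "smooth_on I \<alpha>"
    and \<alpha>: "\<And>s. s \<in> I \<Longrightarrow> (\<alpha> has_vector_derivative a s) (at s)"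
    and a: "\<And>s. s \<in> I \<Longrightarrow> (a has_vector_derivative a' s) (at s)"
    and \<beta>: "\<And>t. t \<in> J \<Longrightarrow> (\<beta> has_vector_derivative b t) (at t)"
    and b: "\<And>t. t \<in> J \<Longrightarrow> (b has_vector_derivative b' t) (at t)"
    and nz: "\<And>s t. s \<in> I \<Longrightarrow> t \<in> J \<Longrightarrow> cross3 (a s) (b t) \<noteq> 0"
    and eq: "\<And>s t. s \<in> I \<Longrightarrow> t \<in> J \<Longrightarrow> soliton_eq v (a s) (a' s) (b t) (b' t)"
    and line: "\<And>t. t \<in> J \<Longrightarrow> cross3 (b t) (b' t) = 0"
  shows "\<exists>S. (\<lambda>(s, t). \<alpha> s + \<beta> t) ` (I \<times> J) \<subseteq> S \<and> (is_plane S \<or> grim_reaper v S)"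
proof -
  obtain s0 t0 where st0: "s0 \<in> I" "t0 \<in> J" using I J by blast
  have b0: "b t \<noteq> 0" if "t \<in> J" for t using nz[OF st0(1) that] by auto
  obtain w where w': "\<And>t. t \<in> J \<Longrightarrow> sgn (b t) = w"
    using constant_direction[OF J(1,2) b b0 line] by blast
  have bw: "b t = norm (b t) *\<^sub>R w" if "t \<in> J" for t
    using w'[OF that, symmetric] b0[OF that] by (simp add: sgn_div_norm)
  have "norm w = 1" using w'[OF st0(2), symmetric] b0[OF st0(2)] by (simp add: norm_sgn)
  then have w: "w \<bullet> w = 1" by (simp add: power2_norm_eq_inner[symmetric])
  \<comment> \<open>The component of \<beta> orthogonal to \<open>w\<close> is constant, since its
    velocity is parallel to \<open>w\<close>.\<close>
  have "((\<lambda>t. \<beta> t - (w \<bullet> \<beta> t) *\<^sub>R w) has_vector_derivative 0) (at t within J)" if "t \<in> J" for t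
  proof -
    have "((\<lambda>t. (w \<bullet> \<beta> t) *\<^sub>R w) has_vector_derivative (w \<bullet> b t) *\<^sub>R w) (at t)"
      using has_vector_derivative_inner_left[OF \<beta>[OF that], of w]
      by (auto intro!: derivative_eq_intros)
    from has_vector_derivative_diff[OF \<beta>[OF that] this]
    have "((\<lambda>t. \<beta> t - (w \<bullet> \<beta> t) *\<^sub>R w) has_vector_derivative b t - (w \<bullet> b t) *\<^sub>R w) (at t)" .
    moreover have "b t - (w \<bullet> b t) *\<^sub>R w = 0"
      using bw[OF that] w by (metis diff_self inner_scaleR_right mult.right_neutral)
    ultimately show ?thesis by (simp add: has_vector_derivative_at_within)
  qed
  then obtain k where "\<And>t. t \<in> J \<Longrightarrow> \<beta> t - (w \<bullet> \<beta> t) *\<^sub>R w = k"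
    using has_vector_derivative_zero_constant[of J] J by (auto simp: is_interval_convex_1)
  then have \<beta>k: "\<beta> t = k + (w \<bullet> \<beta> t) *\<^sub>R w" if "t \<in> J" for t
    using that by (metis diff_add_cancel)
  define \<gamma> where "\<gamma> s = \<alpha> s + k" for s
  define X where "X = (\<lambda>(s, r). \<gamma> s + r *\<^sub>R w)"
  have sub: "(\<lambda>(s, t). \<alpha> s + \<beta> t) ` (I \<times> J) \<subseteq> X ` (I \<times> UNIV)"
  proof clarify
    fix s t assume "s \<in> I" "t \<in> J"
    then have "\<alpha> s + \<beta> t = X (s, w \<bullet> \<beta> t)" using \<beta>k[of t] by (simp add: X_def \<gamma>_def)
    then show "\<alpha> s + \<beta> t \<in> X ` (I \<times> UNIV)" using \<open>s \<in> I\<close> by blast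
  qed
  have \<gamma>: "(\<gamma> has_vector_derivative a s) (at s)" if "s \<in> I" for s
    using has_vector_derivative_add[OF \<alpha>[OF that] has_vector_derivative_const[of k]] by (simp add: \<gamma>_def[abs_def])
  have sm\<gamma>: "smooth_on I \<gamma>"
    using sm I by (auto simp: smooth_on_def \<gamma>_def[abs_def] intro!: Ck_on_add Ck_on_const)
  define l where "l = norm (b t0)"
  have l: "b t0 = l *\<^sub>R w" "l \<noteq> 0" using bw st0 b0 by (auto simp: l_def)
  have nzw: "cross3 (a s) w \<noteq> 0" if "s \<in> I" for s
    using nz[OF that st0(2)] l by (auto simp: cross_mult_right)
  have eqw: "soliton_eq v (a s) (a' s) w 0" if "s \<in> I" for s
  proof -
    have "cross3 (b t0) (b' t0) = 0" using line st0 by blast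
    then have "cross3 (a s) (b t0) \<bullet> b' t0 = 0" by (simp add: cross_triple[of "a s"])
    then have "cross3 (a s) w \<bullet> b' t0 = 0" using l by (simp add: cross_mult_right)
    \<comment> \<open>Both sides are cubic in the length of \<open>b t0\<close>, and the
      acceleration term of \<beta> has dropped out, so \<open>b t0\<close> may be replaced by
      \<open>w\<close> and \<open>b' t0\<close> by 0.\<close>
    then have "l ^ 3 * ((w \<bullet> w) * (cross3 (a s) w \<bullet> a' s)) =
        l ^ 3 * (2 * (cross3 (a s) w \<bullet> cross3 (a s) w) * (cross3 (a s) w \<bullet> v))"
      using eq[OF that st0(2)] unfolding soliton_eq_def l(1)
      by (simp add: cross_mult_right power3_eq_cube algebra_simps)
    then show ?thesis using l(2) by (simp add: soliton_eq_def)
  qed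
  show ?thesis
  proof (cases "\<exists>s\<in>I. cross3 (a s) w \<bullet> v = 0")
    case True
    then have zero: "cross3 (a s) w \<bullet> v = 0" if "s \<in> I" for s
      using translating_cylinder_dichotomy[OF I(1,2) \<gamma> a w nzw eqw _ that] by blast
    have dc: "((\<lambda>s. cross3 (a s) w) has_vector_derivative cross3 (a' s) w) (at s)" if "s \<in> I" for s
      using bounded_linear.has_vector_derivative[OF bounded_bilinear.bounded_linear_left[OF bounded_bilinear_cross3] a[OF that]] .
    \<comment> \<open>The product of the normal with its derivative is a multiple of <c, a'>, which
      the soliton equation forces to be zero when <c, v> = 0. Hence the normal direction is constant
      and the cylinder is planar.\<close>
    have "cross3 (cross3 (a s) w) (cross3 (a' s) w) = 0" if "s \<in> I" for s
    proof -
      have "cross3 (a s) w \<bullet> a' s = 0"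
        using eqw[OF that] w zero[OF that] by (simp add: soliton_eq_def)
      moreover have "cross3 (a s) w \<bullet> a' s = - (cross3 (a s) (a' s) \<bullet> w)"
        using cross_triple[of w "a s" "a' s"] by (simp add: cross_skew[of "a s" w])
      ultimately show ?thesis
        by (simp add: cross3_cross3_common inner_commute[of w "cross3 (a s) (a' s)"])
    qed
    then obtain n where n: "\<And>s. s \<in> I \<Longrightarrow> sgn (cross3 (a s) w) = n"
      using constant_direction[OF I(1,2) dc nzw] by blast
    have n0: "n \<noteq> 0" using n[OF st0(1)] nzw[OF st0(1)] by (metis sgn_zero_iff)
    have nw: "n \<bullet> w = 0" unfolding n[OF st0(1), symmetric] by (simp add: sgn_div_norm)
    have na: "n \<bullet> a s = 0" if "s \<in> I" for s unfolding n[OF that, symmetric] by (simp add: sgn_div_norm)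
    have "\<exists>d. \<forall>s\<in>I. n \<bullet> \<gamma> s = d"
    proof (rule has_field_derivative_zero_constant)
      show "convex I" using I(1) by (simp add: is_interval_convex_1)
      fix s assume "s \<in> I"
      then have "((\<lambda>s. n \<bullet> \<gamma> s) has_real_derivative 0) (at s)"
        using has_vector_derivative_inner_left[OF \<gamma>, of s n] na by simp
      then show "((\<lambda>s. n \<bullet> \<gamma> s) has_real_derivative 0) (at s within I)"
        by (rule has_field_derivative_at_within)
    qed
    then obtain d where "\<And>s. s \<in> I \<Longrightarrow> n \<bullet> \<gamma> s = d" by blast
    then have d: "n \<bullet> X q = d" if "q \<in> I \<times> UNIV" for q
      using nw that by (cases q) (simp add: X_def inner_add_right)
    then have "X ` (I \<times> UNIV) \<subseteq> {x. n \<bullet> x = d}" by blast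
    then show ?thesis
      using subset_trans[OF sub] is_plane_hyperplane[OF n0, of d] by (intro exI conjI disjI1)
  next
    case False
    then have "translating_soliton v (X ` (I \<times> UNIV))"
      unfolding X_def by (intro translating_cylinder_image[OF I sm\<gamma> \<gamma> a w nzw eqw]) blast+
    moreover have "connected (X ` (I \<times> UNIV))"
    proof (rule connected_continuous_image)
      have "continuous_on I \<gamma>"
        using \<gamma> by (meson continuous_at_imp_continuous_on has_vector_derivative_continuous)
      then show "continuous_on (I \<times> UNIV) X"
        unfolding X_def case_prod_unfold
        by (intro continuous_intros continuous_on_compose2[OF _ continuous_on_fst[OF continuous_on_id]]) auto
      show "connected (I \<times> (UNIV :: real set))"
        using I by (simp add: connected_Times is_interval_connected)
    qed
    moreover have "cylindrical (X ` (I \<times> UNIV))"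
      unfolding cylindrical_def
    proof (intro exI conjI allI)
      show "w \<noteq> 0" using w by auto
      fix r
      have "(\<lambda>q. r *\<^sub>R w + X q) ` (I \<times> UNIV) = X ` (\<lambda>(s, x). (s, r + x)) ` (I \<times> UNIV)"
        unfolding image_image by (intro image_cong) (auto simp: X_def algebra_simps)
      also have "(\<lambda>(s, x). (s, r + x)) ` (I \<times> UNIV) = I \<times> UNIV"
        by (force intro: rev_image_eqI[of "(_, _ - r)"])
      finally show "(+) (r *\<^sub>R w) ` X ` (I \<times> UNIV) = X ` (I \<times> UNIV)" by (simp add: image_image)
    qed
    ultimately have M: "translating_soliton v (X ` (I \<times> UNIV)) \<and> connected (X ` (I \<times> UNIV)) \<and>
      cylindrical (X ` (I \<times> UNIV))" by (intro conjI)
    show ?thesis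
    \<comment> \<open>Non-planarity is the remaining clause of \<open>grim_reaper\<close>; if it
      fails, the first alternative holds.\<close>
    proof (cases "\<exists>P. is_plane P \<and> X ` (I \<times> UNIV) \<subseteq> P")
      case True
      then obtain P where "is_plane P" "X ` (I \<times> UNIV) \<subseteq> P" by (elim exE conjE)
      then show ?thesis using subset_trans[OF sub] by (intro exI[of _ P] conjI disjI1)
    next
      case False
      with M have "grim_reaper v (X ` (I \<times> UNIV))" by (simp only: grim_reaper_def) simp
      then show ?thesis using sub by (intro exI conjI disjI2)
    qed
  qed
qed

subsection \<open>The classification\<close>

theorem theorem1:
  fixes v :: "real^3" and I J :: "real set" and \<alpha> \<beta> :: "real \<Rightarrow> real^3"
  assumes "v \<noteq> 0"
    and "open I" and "is_interval I"
    and "open J" and "is_interval J"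
    and "smooth_on I \<alpha>" and "smooth_on J \<beta>"
    and "\<exists>P. is_plane P \<and> \<alpha> ` I \<subseteq> P"
    and "\<exists>Q. is_plane Q \<and> \<beta> ` J \<subseteq> Q"
    and "soliton_patch v (I \<times> J) (\<lambda>(s, t). \<alpha> s + \<beta> t)"
  shows "(\<exists>P. is_plane P \<and> (\<lambda>(s, t). \<alpha> s + \<beta> t) ` (I \<times> J) \<subseteq> P) \<or>
         (\<exists>M. grim_reaper v M \<and> (\<lambda>(s, t). \<alpha> s + \<beta> t) ` (I \<times> J) \<subseteq> M)"
proof (cases "I = {} \<or> J = {}")
  case True
  \<comment> \<open>The image is empty, and the plane containing \<alpha> serves.\<close>
  then show ?thesis using assms(8) by auto
next
  case False
  then have ne: "I \<noteq> {}" "J \<noteq> {}" by auto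
  obtain a a' where \<alpha>: "\<And>s. s \<in> I \<Longrightarrow> (\<alpha> has_vector_derivative a s) (at s)"
    and a: "\<And>s. s \<in> I \<Longrightarrow> (a has_vector_derivative a' s) (at s)"
    using smooth_on_imp_C2[OF \<open>smooth_on I \<alpha>\<close>] by blast
  obtain b b' where \<beta>: "\<And>t. t \<in> J \<Longrightarrow> (\<beta> has_vector_derivative b t) (at t)"
    and b: "\<And>t. t \<in> J \<Longrightarrow> (b has_vector_derivative b' t) (at t)"
    using smooth_on_imp_C2[OF \<open>smooth_on J \<beta>\<close>] by blast
  have nz: "cross3 (a s) (b t) \<noteq> 0" if st: "s \<in> I" "t \<in> J" for s t
  proof
    assume 0: "cross3 (a s) (b t) = 0"
    have "inj (frechet_derivative (\<lambda>(s, t). \<alpha> s + \<beta> t) (at (s, t)))"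
      using assms(10) st by (simp add: soliton_patch_def regular_patch_def)
    then have "inj (\<lambda>w :: real \<times> real. fst w *\<^sub>R a s + snd w *\<^sub>R b t)"
      by (rule back_subst[of inj])
        (rule mean_curvature_sum_of_curves(1)[OF assms(2,4) st \<alpha> \<beta> a[OF st(1)] b[OF st(2)]])
    then have inj: "h = 0 \<and> k = 0" if "h *\<^sub>R a s + k *\<^sub>R b t = 0" for h k
      using that injD[of _ "(h, k)" "(0, 0)"] by fastforce
    \<comment> \<open>The double product b x (a x b) turns the vanishing of a x b into a linear
      relation. Injectivity of dX then gives |b|^2 = 0, and b = 0 contradicts injectivity
      again.\<close>
    have "(b t \<bullet> b t) *\<^sub>R a s + (- (b t \<bullet> a s)) *\<^sub>R b t = cross3 (b t) (cross3 (a s) (b t))"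
      by (simp add: Lagrange)
    then have "(b t \<bullet> b t) *\<^sub>R a s + (- (b t \<bullet> a s)) *\<^sub>R b t = 0" by (simp only: 0 cross_zero_right)
    from inj[OF this] have "b t = 0" by simp
    then show False using inj[of 0 1] by simp
  qed
  have eq: "soliton_eq v (a s) (a' s) (b t) (b' t)" if st: "s \<in> I" "t \<in> J" for s t
    using assms(10) st soliton_equation_iff[OF assms(2,4) st \<alpha> \<beta> a[OF st(1)] b[OF st(2)] nz[OF st]]
    by (auto simp: soliton_patch_def soliton_eq_def)
  obtain P Q where P: "is_plane P" "\<alpha> ` I \<subseteq> P" and Q: "is_plane Q" "\<beta> ` J \<subseteq> Q"
    using assms(8,9) by blast
  obtain n1 d1 where n1P: "n1 \<bullet> n1 = 1" "P = {x. n1 \<bullet> x = d1}" using is_plane_unit_normal[OF P(1)] .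
  obtain n2 d2 where n2Q: "n2 \<bullet> n2 = 1" "Q = {x. n2 \<bullet> x = d2}" using is_plane_unit_normal[OF Q(1)] .
  have n1: "n1 \<bullet> n1 = 1" "\<And>s. s \<in> I \<Longrightarrow> n1 \<bullet> \<alpha> s = d1" using P n1P by auto
  have n2: "n2 \<bullet> n2 = 1" "\<And>t. t \<in> J \<Longrightarrow> n2 \<bullet> \<beta> t = d2" using Q n2Q by auto
  show ?thesis
  proof (cases "cross3 n1 n2 = 0")
    case True
    define c where "c = n1 \<bullet> n2"
    \<comment> \<open>The planes are parallel here, so the sum stays in a plane parallel to
      both.\<close>
    have "n1 = c *\<^sub>R n2"
      using Lagrange[of n2 n2 n1] n2(1) True by (simp add: cross_skew[of n2 n1] c_def inner_commute)
    then have "n1 \<bullet> (\<alpha> s + \<beta> t) = d1 + c * d2" if "s \<in> I" "t \<in> J" for s t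
      using n1(2)[OF that(1)] n2(2)[OF that(2)] by (metis inner_add_right inner_scaleR_left)
    then have "(\<lambda>(s, t). \<alpha> s + \<beta> t) ` (I \<times> J) \<subseteq> {x. n1 \<bullet> x = d1 + c * d2}" by auto
    moreover have "n1 \<noteq> 0" using n1 by auto
    ultimately show ?thesis using is_plane_hyperplane by blast
  next
    case False
    have "n1 \<bullet> a s = 0" if "s \<in> I" for s using derivative_in_plane[OF assms(2) that \<alpha>[OF that] n1(2)] .
    moreover have "n2 \<bullet> b t = 0" if "t \<in> J" for t using derivative_in_plane[OF assms(4) that \<beta>[OF that] n2(2)] .
    ultimately have "(\<forall>s\<in>I. cross3 (a s) (a' s) = 0) \<or> (\<forall>t\<in>J. cross3 (b t) (b' t) = 0)"
      by (intro soliton_of_planar_curves_straight[OF assms(2,4,1) n1(1) n2(1) False a b _ _ eq])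
    then have "\<exists>S. (\<lambda>(s, t). \<alpha> s + \<beta> t) ` (I \<times> J) \<subseteq> S \<and> (is_plane S \<or> grim_reaper v S)"
    proof
      assume "\<forall>t\<in>J. cross3 (b t) (b' t) = 0"
      then show ?thesis
        by (intro sum_with_line[OF assms(3,2) ne(1) assms(5,4) ne(2) assms(6) \<alpha> a \<beta> b nz eq]) auto
    next
      assume "\<forall>s\<in>I. cross3 (a s) (a' s) = 0"
      \<comment> \<open>When \<alpha> is the straight curve, the roles are exchanged: the equation
        is symmetric and the image is unchanged.\<close>
      then have "\<exists>S. (\<lambda>(t, s). \<beta> t + \<alpha> s) ` (J \<times> I) \<subseteq> S \<and> (is_plane S \<or> grim_reaper v S)"
        using nz eq
        by (intro sum_with_line[OF assms(5,4) ne(2) assms(3,2) ne(1) assms(7) \<beta> b \<alpha> a])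
           (auto simp: soliton_eq_swap cross_skew[of "b _"])
      moreover have "(\<lambda>(t, s). \<beta> t + \<alpha> s) ` (J \<times> I) = (\<lambda>(s, t). \<alpha> s + \<beta> t) ` (I \<times> J)"
        by (auto simp: image_iff add.commute)
      ultimately show ?thesis by simp
    qed
    then show ?thesis by blast
  qed
qed

end
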